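(* Let $R_1,R_2$ be consistent triple sets with $\mathrm{cl}(R_1)=\mathrm{cl}(R_2)$. Then for each $R_1'\in\min(\mathfrak{sc}(R_1))$ and each $R_2'\in\min(\mathfrak{sc}(R_2))$ we have $|R_1'|=|R_2'|$.
   Context: A rooted tree $T$ has a distinguished inner vertex (root); leaves are degree-1 vertices; inner vertices other than the root have degree at least 3. A triple $ab|c$ is the rooted binary tree on leaves $a,b,c$ where the path from $a$ to $b$ avoids the path from $c$ to the root; $ab|c=ba|c$. A rooted tree displays $ab|c$ if $a,b,c$ are leaves and the path from $a$ to $b$ does not intersect the path from $c$ to the root. $\mathcal R(T)$ is the set of triples displayed by $T$. A triple set is consistent if some rooted tree displays all its triples. $L_R$ is the set of leaves appearing in $R$. $\mathrm{cl}(R)=\bigcap\mathcal R(T)$ over all rooted trees $T$ with leaf set $L_R$ displaying $R$. $\mathfrak{sc}(R)=\{R'\subseteq R:\mathrm{cl}(R')=\mathrm{cl}(R)\}$, and $\min(\mathfrak{sc}(R))$ is the set of its inclusion-minimal elements. *)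

theory Defs
  imports
    "HOL-Library.Infinite_Typeclass"
    "Graph_Theory.Pair_Digraph"
    "Graph_Theory.Digraph_Component"
begin

section \<open>Rooted trees\<close>

text \<open>
  Finite simple undirected graphs are represented by the symmetric loop-free digraphs of
  \<^locale>\<open>pair_graph\<close>, so \<^const>\<open>out_degree\<close> is the usual vertex degree. The constant
  \<^const>\<open>tree\<close> of the library is not applicable: in a symmetric digraph every edge
  yields a directed cycle of length two. A cycle of the undirected graph is a directed cycle
  of length at least three.
\<close>

definition deg :: "'a pair_pre_digraph \<Rightarrow> 'a \<Rightarrow> nat" where
  "deg T v = out_degree (with_proj T) v"

definition undirected_tree :: "'a pair_pre_digraph \<Rightarrow> bool" where
  "undirected_tree T \<longleftrightarrow>
     pair_graph T \<and>
     Digraph_Component.connected (with_proj T) \<and>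
     \<not> (\<exists>p. pre_digraph.cycle (with_proj T) p \<and> 3 \<le> length p)"

definition leaves :: "'a pair_pre_digraph \<Rightarrow> 'a set" where
  "leaves T = {v \<in> pverts T. deg T v = 1}"

definition inner_vertices :: "'a pair_pre_digraph \<Rightarrow> 'a set" where
  "inner_vertices T = pverts T - leaves T"

text \<open>The one-vertex tree is admitted; it is the only rooted tree without leaves.\<close>

definition rooted_tree :: "'a pair_pre_digraph \<Rightarrow> 'a \<Rightarrow> bool" where
  "rooted_tree T \<rho> \<longleftrightarrow>
     undirected_tree T \<and>
     \<rho> \<in> inner_vertices T \<and>
     (\<forall>v \<in> inner_vertices T - {\<rho>}. 3 \<le> deg T v)"

definition path_verts :: "'a pair_pre_digraph \<Rightarrow> 'a \<Rightarrow> 'a \<Rightarrow> 'a set" where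
  "path_verts T u v =
     set (pre_digraph.awalk_verts (with_proj T) u (THE p. pre_digraph.apath (with_proj T) u p v))"


section \<open>Triples\<close>

text \<open>
  The rooted binary tree \<open>ab|c\<close> is determined, up to an isomorphism fixing its leaves, by
  the unordered pair of \<open>a\<close> and \<open>b\<close> together with \<open>c\<close>.
\<close>

type_synonym 'a triple = "'a set \<times> 'a"

definition triple :: "'a \<Rightarrow> 'a \<Rightarrow> 'a \<Rightarrow> 'a triple" where
  "triple a b c = ({a, b}, c)"

definition triple_set :: "'a triple set \<Rightarrow> bool" where
  "triple_set R \<longleftrightarrow> (\<forall>t \<in> R. \<exists>a b c. distinct [a, b, c] \<and> t = triple a b c)"

definition displayed_triples :: "'a pair_pre_digraph \<Rightarrow> 'a \<Rightarrow> 'a triple set" where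
  "displayed_triples T \<rho> =
     {triple a b c | a b c.
        distinct [a, b, c] \<and> a \<in> leaves T \<and> b \<in> leaves T \<and> c \<in> leaves T \<and>
        path_verts T a b \<inter> path_verts T c \<rho> = {}}"

definition leaf_set :: "'a triple set \<Rightarrow> 'a set" where
  "leaf_set R = (\<Union>(A, c) \<in> R. insert c A)"

text \<open>
  Leaves are themselves vertices, and trees range over graphs with vertices in the type of
  the leaves. That type has to be infinite: then every finite rooted tree whose leaves lie
  in \<^typ>\<open>'a\<close> has, whatever its inner vertices are, an isomorphic copy over
  \<^typ>\<open>'a\<close> with the same leaves and the same displayed triples, so ranging over these graphs
  amounts to ranging over all rooted trees.
\<close>

definition consistent :: "'a::infinite triple set \<Rightarrow> bool" where
  "consistent R \<longleftrightarrow> (\<exists>T \<rho>. rooted_tree T \<rho> \<and> R \<subseteq> displayed_triples T \<rho>)"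

definition cl :: "'a::infinite triple set \<Rightarrow> 'a triple set" where
  "cl R = \<Inter> {displayed_triples T \<rho> | T \<rho>.
                rooted_tree T \<rho> \<and> leaves T = leaf_set R \<and> R \<subseteq> displayed_triples T \<rho>}"

definition sc :: "'a::infinite triple set \<Rightarrow> 'a triple set set" where
  "sc R = {R'. R' \<subseteq> R \<and> cl R' = cl R}"

definition inclusion_minimal :: "'b set set \<Rightarrow> 'b set set" where
  "inclusion_minimal \<S> = {M \<in> \<S>. \<forall>N \<in> \<S>. N \<subseteq> M \<longrightarrow> N = M}"

end

theory Submission
  imports Defs
begin

text \<open>
  A rooted tree enters only through the laminar family of the leaf sets below its vertices, and
  it displays \<open>ab|c\<close> iff some cluster contains \<open>a\<close> and \<open>b\<close> but not \<open>c\<close>. By Aho's algorithm and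
  the theorem of Bryant and Steel, \<open>ab|c\<close> lies in \<open>cl R\<close> iff for some leaf set \<open>X\<close> the Aho graph
  of \<open>R\<close> on \<open>X\<close> has exactly two components, one containing \<open>a\<close> and \<open>b\<close> and the other \<open>c\<close>.

  Fix a closed set \<open>C\<close>. For leaves \<open>a \<noteq> c\<close> there is a largest pair \<open>(A, B)\<close> with \<open>a \<in> A\<close>, \<open>c \<in> B\<close>
  such that \<open>C\<close> contains all triples \<open>xy|z\<close> with \<open>x, y\<close> on one side and \<open>z\<close> on the other, and
  each triple of \<open>C\<close> is split in this way by exactly one of these pairs. Consider the graph whose
  vertices are the pairs \<open>((A, B), x)\<close> with \<open>x \<in> A\<close>, modulo the components of the Aho graph of \<open>C\<close> on
  \<open>A\<close>; a triple \<open>xy|z\<close> split by \<open>(A, B)\<close> is an edge joining \<open>x\<close> and \<open>y\<close>. A subset of \<open>C\<close>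
  has closure \<open>C\<close> iff its edges have the same connected components as all edges together, by
  induction on the size of \<open>A \<union> B\<close>, because a triple inside \<open>A\<close> is split by a pair contained in \<open>A\<close>.
  Hence the minimal representative sets are the bases of a graphic matroid.
\<close>

subsection \<open>Graphic matroids\<close>

text \<open>Elements of type \<open>'e\<close> are the edges of a multigraph, in which loops and
  parallel edges may occur. The pairs in \<open>F\<close> are always present, so
  \<open>link S\<close> is the connectivity relation of \<open>S\<close> in the graph with
  \<open>F\<close> contracted.\<close>

locale edge_system =
  fixes F :: "'v rel" and ends :: "'e \<Rightarrow> 'v \<times> 'v"
  assumes sym_F: "sym F"
begin

definition link :: "'e set \<Rightarrow> 'v rel" where
  "link S = (F \<union> ends ` S \<union> (ends ` S)\<inverse>)\<^sup>*"

lemma link_refl [simp]: "(x, x) \<in> link S"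
  by (simp add: link_def)

lemma link_trans: "(x, y) \<in> link S \<Longrightarrow> (y, z) \<in> link S \<Longrightarrow> (x, z) \<in> link S"
  unfolding link_def by (rule rtrancl_trans)

lemma link_sym: "(x, y) \<in> link S \<Longrightarrow> (y, x) \<in> link S"
proof -
  have "sym (F \<union> ends ` S \<union> (ends ` S)\<inverse>)"
    using sym_F by (auto simp: sym_def)
  then show "(x, y) \<in> link S \<Longrightarrow> (y, x) \<in> link S"
    unfolding link_def by (meson sym_rtrancl symD)
qed

lemma ends_in_link: "e \<in> S \<Longrightarrow> ends e \<in> link S"
  unfolding link_def by (cases "ends e") (auto intro!: r_into_rtrancl intro: rev_image_eqI)

lemma link_mono: "S \<subseteq> S' \<Longrightarrow> link S \<subseteq> link S'"
  unfolding link_def by (rule rtrancl_mono) auto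

lemma link_subset:
  assumes "ends ` S \<subseteq> link S'"
  shows "link S \<subseteq> link S'"
proof (rule subrelI)
  fix x y assume "(x, y) \<in> link S"
  then show "(x, y) \<in> link S'"
    unfolding link_def[of S]
  proof (induction rule: rtrancl_induct)
    case base
    then show ?case by simp
  next
    case (step y z)
    have "(y, z) \<in> link S'"
    proof -
      have "F \<subseteq> link S'" unfolding link_def by auto
      then show ?thesis using step(2) assms link_sym by blast
    qed
    with step(3) show ?case by (rule link_trans)
  qed
qed

text \<open>A path that uses \<open>e\<close> several times can be shortened to one that uses it at
  most once, in one of its two directions.\<close>

lemma link_insert_cases:
  assumes "(x, y) \<in> link (insert e S)" and "ends e = (u, v)"
  shows "(x, y) \<in> link S \<or> (x, u) \<in> link S \<and> (v, y) \<in> link S \<or> (x, v) \<in> link S \<and> (u, y) \<in> link S"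
  using assms(1) unfolding link_def[of "insert e S"]
proof (induction rule: rtrancl_induct)
  case base
  then show ?case by simp
next
  case (step y z)
  have "(y, z) \<in> link S \<or> (y = u \<and> z = v) \<or> (y = v \<and> z = u)"
    using step(2) assms(2) unfolding link_def by auto
  then show ?case
    using step(3) link_trans link_sym link_refl by metis
qed

text \<open>A path joining the ends of \<open>f\<close> has to run through \<open>e\<close>. Its two
  remaining pieces together with \<open>f\<close> join the ends of \<open>e\<close>.\<close>

lemma exchange:
  assumes "ends f \<in> link (insert e S)" and "ends f \<notin> link S"
  shows "ends e \<in> link (insert f S)"
proof -
  obtain u v where e: "ends e = (u, v)" by fastforce
  obtain x y where f: "ends f = (x, y)" by fastforce
  have xy: "(x, y) \<in> link (insert f S)"
    using ends_in_link[of f "insert f S"] f by simp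
  have mono: "link S \<subseteq> link (insert f S)"
    by (rule link_mono) auto
  from link_insert_cases[OF assms(1)[unfolded f] e] assms(2) f
  consider "(x, u) \<in> link S" "(v, y) \<in> link S" | "(x, v) \<in> link S" "(u, y) \<in> link S"
    by auto
  then have "(u, v) \<in> link (insert f S)"
  proof cases
    case 1
    then show ?thesis using mono xy link_trans link_sym by (meson subsetD)
  next
    case 2
    then show ?thesis using mono xy link_trans link_sym by (meson subsetD)
  qed
  then show ?thesis using e by simp
qed

text \<open>The forests of the graph with \<open>F\<close> contracted.\<close>

definition indep :: "'e set \<Rightarrow> bool" where
  "indep I \<longleftrightarrow> (\<forall>e \<in> I. ends e \<notin> link (I - {e}))"

text \<open>If some \<open>g\<close> in \<open>I - {e}\<close> became dependent, \<open>f\<close>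
  would be to blame; by \<open>exchange\<close>, \<open>f\<close> would then be linked by
  \<open>I - {e}\<close>.\<close>

lemma indep_swap:
  assumes "indep I" and "e \<in> I" and "ends f \<notin> link (I - {e})"
  shows "indep (insert f (I - {e}))"
  unfolding indep_def
proof
  fix g assume g: "g \<in> insert f (I - {e})"
  have f: "f \<notin> I - {e}"
    using assms(3) ends_in_link[of f "I - {e}"] by blast
  show "ends g \<notin> link (insert f (I - {e}) - {g})"
  proof (cases "g = f")
    case True
    then show ?thesis using assms(3) f by simp
  next
    case False
    then have gI: "g \<in> I" "g \<noteq> e" using g by auto
    let ?J = "I - {e} - {g}"
    have "ends g \<notin> link (I - {g})"
      using assms(1) gI by (simp add: indep_def)
    then have "ends g \<notin> link ?J"
      using link_mono[of ?J "I - {g}"] by blast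
    moreover have "insert f (I - {e}) - {g} = insert f ?J"
      using False by blast
    moreover have "insert g ?J = I - {e}"
      using gI by blast
    ultimately show ?thesis
      using exchange[of g f ?J] assms(3) by auto
  qed
qed

text \<open>Steinitz exchange: elements of \<open>I\<close> outside \<open>B\<close> are traded one
  at a time for elements of \<open>B\<close>, which keeps the size of \<open>I\<close>.\<close>

lemma indep_card_le:
  assumes "finite B" and "finite I" and "indep I" and "ends ` I \<subseteq> link B"
  shows "card I \<le> card B"
  using assms(2-)
proof (induction "card (I - B)" arbitrary: I rule: less_induct)
  case less
  show ?case
  proof (cases "I \<subseteq> B")
    case True
    then show ?thesis using assms(1) by (simp add: card_mono)
  next
    case False
    then obtain e where e: "e \<in> I" "e \<notin> B" by blast
    have "ends e \<notin> link (I - {e})"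
      using less(3) e by (simp add: indep_def)
    \<comment> \<open>Otherwise \<open>link B\<close>, which contains \<open>ends e\<close>, would
      lie in \<open>link (I - {e})\<close>.\<close>
    then have "\<not> ends ` B \<subseteq> link (I - {e})"
      using link_subset less(4) e(1) by blast
    then obtain f where f: "f \<in> B" "ends f \<notin> link (I - {e})" by blast
    let ?I = "insert f (I - {e})"
    have fI: "f \<notin> I"
      using f e ends_in_link[of f "I - {e}"] by blast
    have "?I - B = (I - B) - {e}" using f e by blast
    moreover have "card ((I - B) - {e}) < card (I - B)"
      using e less(2) by (intro card_Diff1_less) auto
    ultimately have "card (?I - B) < card (I - B)" by simp
    moreover have "ends ` ?I \<subseteq> link B"
      using less(4) f ends_in_link[of f B] by auto
    moreover have "finite ?I" using less(2) by simp
    moreover have "indep ?I" using indep_swap[OF less(3) e(1) f(2)] .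
    ultimately have "card ?I \<le> card B" using less(1) by blast
    moreover have "card ?I = card I"
      using fI e less(2) card_Suc_Diff1[OF less(2) e(1)] by (simp add: card_insert_disjoint)
    ultimately show ?thesis by simp
  qed
qed

text \<open>A minimal spanning set is independent, because an edge linked by the others could be
  dropped. The exchange bound then applies in both directions.\<close>

lemma minimal_spanning_card_eq:
  assumes S: "S \<subseteq> C" "ends ` C \<subseteq> link S" "\<And>N. N \<subseteq> S \<Longrightarrow> ends ` C \<subseteq> link N \<Longrightarrow> N = S"
    and S': "S' \<subseteq> C" "ends ` C \<subseteq> link S'" "\<And>N. N \<subseteq> S' \<Longrightarrow> ends ` C \<subseteq> link N \<Longrightarrow> N = S'"
    and "finite S" "finite S'"
  shows "card S = card S'"
proof -
  have ind: "indep S" if S: "ends ` C \<subseteq> link S" "\<And>N. N \<subseteq> S \<Longrightarrow> ends ` C \<subseteq> link N \<Longrightarrow> N = S" for S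
    unfolding indep_def
  proof (intro ballI notI)
    fix e assume e: "e \<in> S" "ends e \<in> link (S - {e})"
    have "ends ` S \<subseteq> link (S - {e})"
    proof (rule image_subsetI)
      fix g assume "g \<in> S"
      then show "ends g \<in> link (S - {e})"
        using e ends_in_link[of g "S - {e}"] by (cases "g = e") auto
    qed
    then have "ends ` C \<subseteq> link (S - {e})"
      by (rule subset_trans[OF S(1) link_subset])
    then have "S - {e} = S"
      by (rule S(2)[OF Diff_subset])
    with e(1) show False by blast
  qed
  have "card S \<le> card S'"
    using indep_card_le[OF assms(8,7) ind[OF S(2,3)] subset_trans[OF image_mono[OF S(1)] S'(2)]] .
  moreover have "card S' \<le> card S"
    using indep_card_le[OF assms(7,8) ind[OF S'(2,3)] subset_trans[OF image_mono[OF S'(1)] S(2)]] .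
  ultimately show ?thesis by simp
qed

end

lemma triple_eq_iff: "triple a b c = triple a' b' c' \<longleftrightarrow> ({a, b} = {a', b'}) \<and> c = c'"
  by (simp add: triple_def)

lemma triple_commute: "triple a b c = triple b a c"
  by (simp add: triple_def insert_commute)

subsection \<open>Laminar families\<close>

definition laminar :: "'a set set \<Rightarrow> bool" where
  "laminar H \<longleftrightarrow> (\<forall>X \<in> H. \<forall>Y \<in> H. X \<subseteq> Y \<or> Y \<subseteq> X \<or> X \<inter> Y = {})"

lemma laminarD:
  "laminar H \<Longrightarrow> X \<in> H \<Longrightarrow> Y \<in> H \<Longrightarrow> z \<in> X \<Longrightarrow> z \<in> Y \<Longrightarrow> X \<subseteq> Y \<or> Y \<subseteq> X"
  unfolding laminar_def by blast

text \<open>Clusters may exceed \<open>L\<close>; only their traces on \<open>L\<close> matter, so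
  one family serves for every leaf set.\<close>

definition laminar_triples :: "'a set \<Rightarrow> 'a set set \<Rightarrow> 'a triple set" where
  "laminar_triples L H = {triple a b c | a b c.
     distinct [a, b, c] \<and> a \<in> L \<and> b \<in> L \<and> c \<in> L \<and> (\<exists>X \<in> H. a \<in> X \<and> b \<in> X \<and> c \<notin> X)}"

lemma laminar_triples_iff:
  "triple a b c \<in> laminar_triples L H \<longleftrightarrow>
     distinct [a, b, c] \<and> a \<in> L \<and> b \<in> L \<and> c \<in> L \<and> (\<exists>X \<in> H. a \<in> X \<and> b \<in> X \<and> c \<notin> X)"
  unfolding laminar_triples_def mem_Collect_eq triple_eq_iff doubleton_eq_iff by auto

section \<open>Aho graphs and their components\<close>

definition aho_edges :: "'a triple set \<Rightarrow> 'a set \<Rightarrow> 'a rel" where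
  "aho_edges R X = {(x, y). \<exists>z. x \<in> X \<and> y \<in> X \<and> z \<in> X \<and> triple x y z \<in> R}"

abbreviation aho :: "'a triple set \<Rightarrow> 'a set \<Rightarrow> 'a rel" where
  "aho R X \<equiv> (aho_edges R X)\<^sup>*"

lemma aho_sym: "(x, y) \<in> aho R X \<Longrightarrow> (y, x) \<in> aho R X"
proof -
  have "sym (aho_edges R X)"
    by (auto simp: sym_def aho_edges_def triple_commute)
  then show "(x, y) \<in> aho R X \<Longrightarrow> (y, x) \<in> aho R X"
    by (meson sym_rtrancl symD)
qed

lemma aho_mono: "R \<subseteq> R' \<Longrightarrow> X \<subseteq> X' \<Longrightarrow> aho R X \<subseteq> aho R' X'"
  by (rule rtrancl_mono) (auto simp: aho_edges_def)

definition aho_connected :: "'a triple set \<Rightarrow> 'a set \<Rightarrow> bool" where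
  "aho_connected R X \<longleftrightarrow> (\<forall>x \<in> X. \<forall>y \<in> X. (x, y) \<in> aho R X)"

text \<open>In a tree, and for leaves of \<open>X\<close>, this is the relation of lying below the
  same child of the last common ancestor of \<open>X\<close>.\<close>

definition together :: "'a set set \<Rightarrow> 'a set \<Rightarrow> 'a \<Rightarrow> 'a \<Rightarrow> bool" where
  "together H X x y \<longleftrightarrow> x = y \<or> (\<exists>Y \<in> H. x \<in> Y \<and> y \<in> Y \<and> \<not> X \<subseteq> Y)"

text \<open>The two clusters share \<open>y\<close>, so they are nested, and the larger one still
  fails to cover \<open>X\<close>.\<close>

lemma together_trans:
  assumes "laminar H" "together H X x y" "together H X y z"
  shows "together H X x z"
  using assms laminarD[OF assms(1)] unfolding together_def by (smt (verit) subset_trans subset_iff)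

text \<open>The cluster that displays a triple inside \<open>X\<close> misses the third leaf, hence
  does not cover \<open>X\<close>.\<close>

lemma aho_together:
  assumes "laminar H" "R \<subseteq> laminar_triples L H" "(x, y) \<in> aho R X"
  shows "together H X x y"
  using assms(3)
proof (induction rule: rtrancl_induct)
  case base
  then show ?case by (simp add: together_def)
next
  case (step y z)
  then obtain w where "w \<in> X" "triple y z w \<in> laminar_triples L H"
    using assms(2) by (auto simp: aho_edges_def)
  then have "together H X y z"
    unfolding laminar_triples_iff together_def by auto
  with step show ?case using together_trans[OF assms(1)] by blast
qed

text \<open>A largest cluster around \<open>x\<close> not covering \<open>X\<close> misses some
  \<open>z\<close>. A cluster joining \<open>x\<close> to \<open>z\<close> is nested with it and
  would be larger.\<close>

lemma not_all_together:
  assumes "laminar H" "finite X" "x \<in> X" "y \<in> X" "x \<noteq> y"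
  shows "\<exists>z \<in> X. \<not> together H X x z"
proof (rule ccontr)
  assume "\<not> ?thesis"
  then have all: "together H X x z" if "z \<in> X" for z using that by blast
  let ?P = "\<lambda>Y. Y \<in> H \<and> x \<in> Y \<and> \<not> X \<subseteq> Y"
  have "\<exists>Y. ?P Y" using all[OF assms(4)] assms(5) by (auto simp: together_def)
  \<comment> \<open>The family and its members may be infinite, so the maximum is taken over the
    traces on \<open>X\<close>.\<close>
  moreover have "\<forall>Y. ?P Y \<longrightarrow> card (X \<inter> Y) < Suc (card X)"
    using assms(2) by (auto intro: card_mono le_imp_less_Suc)
  ultimately obtain Y where Y: "?P Y" and max: "\<And>Y'. ?P Y' \<Longrightarrow> card (X \<inter> Y') \<le> card (X \<inter> Y)"
    using ex_has_greatest_nat[of ?P _ "\<lambda>Y. card (X \<inter> Y)" "Suc (card X)"] by (metis less_imp_le)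
  from Y obtain z where z: "z \<in> X" "z \<notin> Y" by blast
  then obtain Y' where Y': "?P Y'" "z \<in> Y'"
    using all[OF z(1)] Y by (auto simp: together_def)
  then have "Y \<subseteq> Y'" using laminarD[OF assms(1), of Y Y' x] Y z by blast
  then have "X \<inter> Y \<subset> X \<inter> Y'" using z Y' by blast
  then have "card (X \<inter> Y) < card (X \<inter> Y')" using assms(2) by (simp add: psubset_card_mono)
  with max[OF Y'(1)] show False by simp
qed

lemma not_aho_connected:
  assumes "laminar H" "R \<subseteq> laminar_triples L H" "finite X" "x \<in> X" "y \<in> X" "x \<noteq> y"
  shows "\<not> aho_connected R X"
  using not_all_together[OF assms(1,3-6)] aho_together[OF assms(1,2)] assms(4)
  unfolding aho_connected_def by blast

text \<open>The sound half of Bryant and Steel: if \<open>a\<close> and \<open>c\<close> were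
  together, both components would merge and all of \<open>X\<close> would be together. So a cluster
  joining \<open>a\<close> and \<open>b\<close> without covering \<open>X\<close> must miss
  \<open>c\<close>.\<close>

lemma two_components_triple:
  assumes H: "laminar H" "R \<subseteq> laminar_triples L H"
    and X: "finite X" "X \<subseteq> L" "a \<in> X" "b \<in> X" "c \<in> X"
    and two: "\<And>z. z \<in> X \<Longrightarrow> (a, z) \<in> aho R X \<or> (c, z) \<in> aho R X"
    and ab: "a \<noteq> b" "(a, b) \<in> aho R X"
  shows "triple a b c \<in> laminar_triples L H"
proof -
  have ac: "\<not> together H X a c"
  proof
    assume ac: "together H X a c"
    have "together H X a z" if "z \<in> X" for z
      using two[OF that] aho_together[OF H] together_trans[OF H(1) ac] by blast
    then show False using not_all_together[OF H(1) X(1,3,4) ab(1)] by blast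
  qed
  have tab: "together H X a b" using aho_together[OF H ab(2)] .
  then obtain Y where Y: "Y \<in> H" "a \<in> Y" "b \<in> Y" "\<not> X \<subseteq> Y"
    using ab(1) by (auto simp: together_def)
  moreover have "c \<notin> Y" using ac Y by (auto simp: together_def)
  ultimately show ?thesis
    using X ab(1) ac tab by (auto simp: laminar_triples_iff)
qed

text \<open>The clusters of the tree that Aho's algorithm BUILD computes.\<close>

lemma laminar_family_exists:
  assumes "finite X"
    and "\<And>Y x y. Y \<subseteq> X \<Longrightarrow> x \<in> Y \<Longrightarrow> y \<in> Y \<Longrightarrow> x \<noteq> y \<Longrightarrow> \<not> aho_connected R Y"
  shows "\<exists>H. laminar H \<and> (\<forall>Y \<in> H. Y \<subseteq> X) \<and>
    (\<forall>a b c. triple a b c \<in> R \<longrightarrow> a \<in> X \<longrightarrow> b \<in> X \<longrightarrow> c \<in> X \<longrightarrow> distinct [a, b, c] \<longrightarrow>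
       (\<exists>Y \<in> H. a \<in> Y \<and> b \<in> Y \<and> c \<notin> Y))"
  using assms
proof (induction "card X" arbitrary: X rule: less_induct)
  case less
  define Z where "Z x = {y \<in> X. (x, y) \<in> aho R X}" for x
  define Q where "Q W H \<longleftrightarrow> laminar H \<and> (\<forall>Y \<in> H. Y \<subseteq> W) \<and>
    (\<forall>a b c. triple a b c \<in> R \<longrightarrow> a \<in> W \<longrightarrow> b \<in> W \<longrightarrow> c \<in> W \<longrightarrow> distinct [a, b, c] \<longrightarrow>
       (\<exists>Y \<in> H. a \<in> Y \<and> b \<in> Y \<and> c \<notin> Y))" for W H
  show ?case
  proof (cases "\<exists>x \<in> X. \<exists>y \<in> X. x \<noteq> y")
    case False
    then show ?thesis by (intro exI[of _ "{}"]) (auto simp: laminar_def)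
  next
    case True
    then have nc: "\<not> aho_connected R X" using less(3) by blast
    have ZX: "Z x \<subseteq> X" for x by (auto simp: Z_def)
    have Zself: "x \<in> Z x" if "x \<in> X" for x using that by (simp add: Z_def)
    have Zeq: "Z x = Z y" if "u \<in> Z x" "u \<in> Z y" for x y u
    proof -
      have "(x, u) \<in> aho R X" "(y, u) \<in> aho R X" using that by (simp_all add: Z_def)
      then have "(x, y) \<in> aho R X" "(y, x) \<in> aho R X"
        using aho_sym[of x u R X] aho_sym[of y u R X] by (blast intro: rtrancl_trans)+
      then show ?thesis unfolding Z_def by (blast intro: rtrancl_trans)
    qed
    have "Z x \<noteq> X" if x: "x \<in> X" for x
    proof
      assume "Z x = X"
      then have "\<forall>y \<in> X. (x, y) \<in> aho R X" by (auto simp: Z_def)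
      then have "aho_connected R X"
        unfolding aho_connected_def by (blast intro: rtrancl_trans aho_sym)
      with nc show False ..
    qed
    then have Zless: "card (Z x) < card X" if "x \<in> X" for x
      using that ZX less(2) by (meson psubsetI psubset_card_mono)
    have Q_ex: "\<exists>H. Q (Z x) H" if "x \<in> X" for x
      unfolding Q_def
    proof (rule less(1)[OF Zless[OF that]])
      show "finite (Z x)" using ZX less(2) finite_subset by blast
    next
      fix Y x' y assume "Y \<subseteq> Z x" "x' \<in> Y" "y \<in> Y" "x' \<noteq> y"
      then show "\<not> aho_connected R Y" using less(3)[of Y x' y] ZX[of x] by simp
    qed
    \<comment> \<open>The subfamily is chosen per component and not per element, so elements of one
      component get the same one.\<close>
    define G where "G W = (SOME H. Q W H)" for W
    have G: "Q (Z x) (G (Z x))" if "x \<in> X" for x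
      unfolding G_def using Q_ex[OF that] by (rule someI_ex)
    let ?H = "\<Union>x \<in> X. insert (Z x) (G (Z x))"
    have sub: "Y \<subseteq> Z x" if "x \<in> X" "Y \<in> insert (Z x) (G (Z x))" for x Y
      using G[OF that(1)] that(2) by (auto simp: Q_def)
    have "laminar ?H"
      unfolding laminar_def
    proof (intro ballI)
      fix Y Y' assume "Y \<in> ?H" "Y' \<in> ?H"
      then obtain x x' where x: "x \<in> X" "Y \<in> insert (Z x) (G (Z x))"
        and x': "x' \<in> X" "Y' \<in> insert (Z x') (G (Z x'))" by blast
      show "Y \<subseteq> Y' \<or> Y' \<subseteq> Y \<or> Y \<inter> Y' = {}"
      proof (cases "Z x = Z x'")
        case True
        then have "Y = Z x \<or> Y \<in> G (Z x)" "Y' = Z x \<or> Y' \<in> G (Z x)" using x x' by auto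
        moreover have "laminar (G (Z x))" using G[OF x(1)] by (simp add: Q_def)
        ultimately show ?thesis using sub[OF x(1)] unfolding laminar_def by blast
      next
        case False
        then show ?thesis using sub[OF x] sub[OF x'] Zeq[of _ x x'] by blast
      qed
    qed
    moreover have "Y \<subseteq> X" if "Y \<in> ?H" for Y using that sub ZX by blast
    moreover have "\<exists>Y \<in> ?H. a \<in> Y \<and> b \<in> Y \<and> c \<notin> Y"
      if t: "triple a b c \<in> R" "a \<in> X" "b \<in> X" "c \<in> X" "distinct [a, b, c]" for a b c
    proof -
      have "(a, b) \<in> aho_edges R X" using t by (auto simp: aho_edges_def)
      then have ab: "a \<in> Z a" "b \<in> Z a" using t by (auto simp: Z_def)
      show ?thesis
      \<comment> \<open>The component of \<open>a\<close> separates the triple unless it contains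
        \<open>c\<close>; in that case the recursive family on the component does.\<close>
      proof (cases "c \<in> Z a")
        case False
        then show ?thesis using ab t(2) by blast
      next
        case True
        then obtain Y where "Y \<in> G (Z a)" "a \<in> Y" "b \<in> Y" "c \<notin> Y"
          using G[OF t(2)] ab t unfolding Q_def by blast
        then show ?thesis using t(2) by blast
      qed
    qed
    ultimately show ?thesis by (intro exI[of _ ?H]) blast
  qed
qed

subsection \<open>The theorem of Bryant and Steel\<close>

text \<open>The two clusters would share \<open>a\<close> without being nested.\<close>

lemma laminar_triples_not_both:
  assumes "laminar H" "triple a b c \<in> laminar_triples L H"
  shows "triple a c b \<notin> laminar_triples L H"
  using assms laminarD[OF assms(1)] unfolding laminar_triples_iff by blast

lemma laminar_triplesE:
  assumes "t \<in> laminar_triples L H"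
  obtains a b c where "t = triple a b c" "distinct [a, b, c]" "a \<in> L" "b \<in> L" "c \<in> L"
  using assms unfolding laminar_triples_def by blast

text \<open>In contrast to \<open>cl\<close>, the leaf set stays fixed when \<open>R\<close>
  shrinks, which makes this a closure operator.\<close>

definition laminar_closure :: "'a set \<Rightarrow> 'a triple set \<Rightarrow> 'a triple set" where
  "laminar_closure L R = \<Inter> {laminar_triples L H | H. laminar H \<and> R \<subseteq> laminar_triples L H}"

lemma laminar_closure_iff:
  "t \<in> laminar_closure L R \<longleftrightarrow> (\<forall>H. laminar H \<longrightarrow> R \<subseteq> laminar_triples L H \<longrightarrow> t \<in> laminar_triples L H)"
  unfolding laminar_closure_def by blast

text \<open>Adding \<open>ac|b\<close> makes \<open>R\<close> inconsistent, so some Aho graph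
  becomes connected that was not connected before. The new triple contributes only the edge between
  \<open>a\<close> and \<open>c\<close>; without it at most the components of \<open>a\<close> and
  of \<open>c\<close> remain.\<close>

lemma closure_separator:
  assumes L: "finite L" and H0: "laminar H0" "R \<subseteq> laminar_triples L H0"
    and t: "triple a b c \<in> laminar_closure L R"
  obtains X where "X \<subseteq> L" "a \<in> X" "b \<in> X" "c \<in> X"
    "\<And>z. z \<in> X \<Longrightarrow> (a, z) \<in> aho R X \<or> (c, z) \<in> aho R X"
proof -
  have abc: "distinct [a, b, c]" "a \<in> L" "b \<in> L" "c \<in> L"
    using t H0 unfolding laminar_closure_iff laminar_triples_iff by blast+
  let ?R = "insert (triple a c b) R"
  have "\<exists>Y x y. Y \<subseteq> L \<and> x \<in> Y \<and> y \<in> Y \<and> x \<noteq> y \<and> aho_connected ?R Y"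
  proof (rule ccontr)
    assume "\<not> ?thesis"
    then have "\<not> aho_connected ?R Y" if "Y \<subseteq> L" "x \<in> Y" "y \<in> Y" "x \<noteq> y" for Y x y
      using that by blast
    then have "\<exists>H. laminar H \<and> (\<forall>Y \<in> H. Y \<subseteq> L) \<and>
      (\<forall>x y z. triple x y z \<in> ?R \<longrightarrow> x \<in> L \<longrightarrow> y \<in> L \<longrightarrow> z \<in> L \<longrightarrow> distinct [x, y, z] \<longrightarrow>
       (\<exists>Y \<in> H. x \<in> Y \<and> y \<in> Y \<and> z \<notin> Y))"
      by (rule laminar_family_exists[OF L])
    then obtain H where H: "laminar H"
      and sep: "\<forall>x y z. triple x y z \<in> ?R \<longrightarrow> x \<in> L \<longrightarrow> y \<in> L \<longrightarrow> z \<in> L \<longrightarrow> distinct [x, y, z] \<longrightarrow>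
       (\<exists>Y \<in> H. x \<in> Y \<and> y \<in> Y \<and> z \<notin> Y)" by auto
    \<comment> \<open>That the leaves of each triple are distinct and lie in \<open>L\<close> comes
      from \<open>H0\<close>; the separating cluster comes from \<open>H\<close>.\<close>
    have R: "?R \<subseteq> laminar_triples L H"
    proof
      fix s assume s: "s \<in> ?R"
      have "\<exists>x y z. s = triple x y z \<and> distinct [x, y, z] \<and> x \<in> L \<and> y \<in> L \<and> z \<in> L"
      proof (cases "s = triple a c b")
        case True
        then show ?thesis using abc by auto
      next
        case False
        then have "s \<in> laminar_triples L H0" using s H0(2) by blast
        then show ?thesis by (metis laminar_triplesE)
      qed
      then obtain x y z where "s = triple x y z" "distinct [x, y, z]" "x \<in> L" "y \<in> L" "z \<in> L"
        by blast
      then show "s \<in> laminar_triples L H"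
        using sep[rule_format, of x y z] s by (simp add: laminar_triples_iff)
    qed
    then have "triple a b c \<in> laminar_triples L H"
      using t H unfolding laminar_closure_iff by blast
    then show False using laminar_triples_not_both[OF H] R by blast
  qed
  then obtain Y x y where Y: "Y \<subseteq> L" "x \<in> Y" "y \<in> Y" "x \<noteq> y" "aho_connected ?R Y" by blast
  have nc: "\<not> aho_connected R Y"
    by (rule not_aho_connected[OF H0 finite_subset[OF Y(1) L] Y(2-4)])
  have edges: "aho_edges ?R Y \<subseteq> aho_edges R Y \<union> {(a, c), (c, a)}"
    unfolding aho_edges_def by (auto simp: triple_eq_iff doubleton_eq_iff)
  have inY: "a \<in> Y" "b \<in> Y" "c \<in> Y"
  proof -
    have "a \<in> Y \<and> b \<in> Y \<and> c \<in> Y"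
    proof (rule ccontr)
      assume "\<not> ?thesis"
      then have "aho_edges ?R Y = aho_edges R Y"
        unfolding aho_edges_def by (auto simp: triple_eq_iff doubleton_eq_iff)
      with Y(5) nc show False by (simp add: aho_connected_def)
    qed
    then show "a \<in> Y" "b \<in> Y" "c \<in> Y" by auto
  qed
  have "(a, z) \<in> aho R Y \<or> (c, z) \<in> aho R Y" if "(a, z) \<in> aho ?R Y" for z
    using that
  proof (induction rule: rtrancl_induct)
    case base
    then show ?case by simp
  next
    case (step u v)
    then consider "(u, v) \<in> aho_edges R Y" | "v = a" | "v = c" using edges by auto
    then show ?case
      using step(3) by cases (auto intro: rtrancl_into_rtrancl)
  qed
  then show thesis
    using that[OF Y(1) inY] Y(5) inY unfolding aho_connected_def by blast
qed

text \<open>The separator leaves open whether \<open>b\<close> is joined to \<open>a\<close> or to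
  \<open>c\<close>, so it is also applied with \<open>a\<close> and \<open>b\<close> exchanged. If
  \<open>b\<close> goes with \<open>c\<close> in \<open>X\<close> and \<open>a\<close> goes with
  \<open>c\<close> in \<open>Y\<close>, then the Aho graph on \<open>X \<union> Y\<close> is
  connected, contradicting consistency.\<close>

lemma closure_two_components:
  assumes L: "finite L" and H0: "laminar H0" "R \<subseteq> laminar_triples L H0"
    and t: "triple a b c \<in> laminar_closure L R"
  obtains X where "X \<subseteq> L" "a \<in> X" "b \<in> X" "c \<in> X" "(a, b) \<in> aho R X"
    "\<And>z. z \<in> X \<Longrightarrow> (a, z) \<in> aho R X \<or> (c, z) \<in> aho R X"
proof -
  obtain X where X: "X \<subseteq> L" "a \<in> X" "b \<in> X" "c \<in> X"
    "\<And>z. z \<in> X \<Longrightarrow> (a, z) \<in> aho R X \<or> (c, z) \<in> aho R X"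
    using closure_separator[OF L H0 t] by blast
  obtain Y where Y: "Y \<subseteq> L" "b \<in> Y" "a \<in> Y" "c \<in> Y"
    "\<And>z. z \<in> Y \<Longrightarrow> (b, z) \<in> aho R Y \<or> (c, z) \<in> aho R Y"
    using closure_separator[OF L H0 t[unfolded triple_commute[of a]]] by blast
  consider "(a, b) \<in> aho R X" | "(b, a) \<in> aho R Y" | "(c, b) \<in> aho R X" "(c, a) \<in> aho R Y"
    using X(5)[OF X(3)] Y(5)[OF Y(3)] by blast
  then show thesis
  proof cases
    case 1
    then show ?thesis using that[OF X(1-4)] X(5) by blast
  next
    case 2
    then have "(a, b) \<in> aho R Y" by (rule aho_sym)
    then show ?thesis using that[OF Y(1,3,2,4)] Y(5) by (meson rtrancl_trans)
  next
    case 3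
    let ?U = "X \<union> Y"
    have XU: "aho R X \<subseteq> aho R ?U" and YU: "aho R Y \<subseteq> aho R ?U"
      by (rule aho_mono; auto)+
    have ca: "(c, a) \<in> aho R ?U" "(c, b) \<in> aho R ?U" using 3 XU YU by auto
    have cz: "(c, z) \<in> aho R ?U" if "z \<in> ?U" for z
    proof (cases "z \<in> X")
      case True
      then have "(a, z) \<in> aho R ?U \<or> (c, z) \<in> aho R ?U" using X(5) XU by blast
      then show ?thesis using ca by (meson rtrancl_trans)
    next
      case False
      then have "(b, z) \<in> aho R ?U \<or> (c, z) \<in> aho R ?U" using that Y(5) YU by blast
      then show ?thesis using ca by (meson rtrancl_trans)
    qed
    have "aho_connected R ?U"
      unfolding aho_connected_def using cz aho_sym[of _ _ R ?U] by (meson rtrancl_trans)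
    moreover have "a \<noteq> b" using t H0 unfolding laminar_closure_iff laminar_triples_iff by auto
    moreover have "finite ?U" using X(1) Y(1) L by (meson finite_Un finite_subset)
    ultimately show ?thesis using not_aho_connected[OF H0, of ?U a b] X(2,3) by blast
  qed
qed

lemma leaf_set_triple:
  assumes "triple a b c \<in> R"
  shows "{a, b, c} \<subseteq> leaf_set R"
proof
  fix x assume "x \<in> {a, b, c}"
  then show "x \<in> leaf_set R"
    using assms unfolding leaf_set_def triple_def by (intro UN_I[of "({a, b}, c)"]) auto
qed

subsection \<open>The matroid of a closed triple set\<close>

text \<open>The family \<open>H0\<close> witnesses that \<open>C\<close> is consistent.\<close>

locale closed_triples =
  fixes L :: "'a set" and C :: "'a triple set" and H0 :: "'a set set"
  assumes finite_L: "finite L"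
    and laminar_H0: "laminar H0" and C_H0: "C \<subseteq> laminar_triples L H0"
    and closed: "laminar_closure L C \<subseteq> C"
begin

section \<open>Inference rules valid in closed triple sets, and the largest separated pairs\<close>

lemma closedI:
  assumes "\<And>H. laminar H \<Longrightarrow> C \<subseteq> laminar_triples L H \<Longrightarrow> t \<in> laminar_triples L H"
  shows "t \<in> C"
  using closed assms by (auto simp: laminar_closure_iff)

lemma in_C:
  assumes "triple a b c \<in> C"
  shows "a \<noteq> b" "a \<noteq> c" "b \<noteq> c" "a \<in> L" "b \<in> L" "c \<in> L"
  using assms C_H0 by (auto simp: laminar_triples_iff)

text \<open>The two clusters share \<open>a\<close>, so the larger one contains \<open>z\<close> and
  \<open>w\<close>.\<close>

lemma merge_left:
  assumes "triple z a c \<in> C" "triple w a c \<in> C" "z \<noteq> w"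
  shows "triple z w c \<in> C"
proof (rule closedI)
  fix H assume H: "laminar H" "C \<subseteq> laminar_triples L H"
  then have 1: "triple z a c \<in> laminar_triples L H" "triple w a c \<in> laminar_triples L H"
    using assms by auto
  then obtain X Y where X: "X \<in> H" "z \<in> X" "a \<in> X" "c \<notin> X" and Y: "Y \<in> H" "w \<in> Y" "a \<in> Y" "c \<notin> Y"
    unfolding laminar_triples_iff by blast
  have "X \<subseteq> Y \<or> Y \<subseteq> X" using laminarD[OF H(1) X(1) Y(1) X(3) Y(3)] .
  then show "triple z w c \<in> laminar_triples L H"
    using 1 X Y assms(3) unfolding laminar_triples_iff by auto
qed

text \<open>If \<open>z\<close> were in the cluster of \<open>c\<close> and \<open>w\<close>, this
  cluster and the one of \<open>z\<close> and \<open>a\<close> would overlap without being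
  nested.\<close>

lemma move_right:
  assumes "triple c w a \<in> C" "triple z a c \<in> C"
  shows "triple c w z \<in> C"
proof (rule closedI)
  fix H assume H: "laminar H" "C \<subseteq> laminar_triples L H"
  then have 1: "triple c w a \<in> laminar_triples L H" "triple z a c \<in> laminar_triples L H"
    using assms by auto
  then obtain X Y where X: "X \<in> H" "c \<in> X" "w \<in> X" "a \<notin> X" and Y: "Y \<in> H" "z \<in> Y" "a \<in> Y" "c \<notin> Y"
    unfolding laminar_triples_iff by blast
  have "z \<notin> X" using laminarD[OF H(1) X(1) Y(1), of z] X Y by blast
  then show "triple c w z \<in> laminar_triples L H"
    using 1 X unfolding laminar_triples_iff by auto
qed

text \<open>The clusters share \<open>b\<close>, and only that of \<open>bc|d\<close> contains
  \<open>c\<close>, so it contains the other and hence \<open>a\<close>.\<close>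

lemma dyadic:
  assumes "triple a b c \<in> C" "triple b c d \<in> C"
  shows "triple a b d \<in> C" "triple a c d \<in> C"
proof -
  have "triple a b d \<in> laminar_triples L H \<and> triple a c d \<in> laminar_triples L H"
    if H: "laminar H" "C \<subseteq> laminar_triples L H" for H
  proof -
    have 1: "triple a b c \<in> laminar_triples L H" "triple b c d \<in> laminar_triples L H"
      using assms H by auto
    then obtain X Y where X: "X \<in> H" "a \<in> X" "b \<in> X" "c \<notin> X" and Y: "Y \<in> H" "b \<in> Y" "c \<in> Y" "d \<notin> Y"
      unfolding laminar_triples_iff by blast
    have "a \<in> Y" using laminarD[OF H(1) X(1) Y(1), of b] X Y by blast
    then show ?thesis using 1 Y unfolding laminar_triples_iff by auto
  qed
  then show "triple a b d \<in> C" "triple a c d \<in> C" by (auto intro: closedI)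
qed

text \<open>The sets \<open>side a c\<close> and \<open>side c a\<close> are the components
  \<open>A\<close> and \<open>B\<close> of the largest pair for \<open>a\<close> and
  \<open>c\<close>.\<close>

definition side :: "'a \<Rightarrow> 'a \<Rightarrow> 'a set" where
  "side a c = insert a {z. triple z a c \<in> C}"

lemma side_subset: "triple a b c \<in> C \<Longrightarrow> side a c \<union> side c a \<subseteq> L"
  using in_C unfolding side_def by auto

text \<open>By \<open>merge_left\<close> and \<open>move_right\<close>, neither set changes when
  \<open>a\<close> is replaced by another element of its side.\<close>

lemma side_eq:
  assumes "x \<in> side a c"
  shows "side x c = side a c" "side c x = side c a"
proof -
  have "side x c = side a c \<and> side c x = side c a"
  proof (cases "x = a")
    case False
    then have t: "triple x a c \<in> C" "triple a x c \<in> C"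
      using assms by (auto simp: side_def triple_commute)
    \<comment> \<open>One inclusion suffices, as the roles of \<open>x\<close> and \<open>y\<close>
      are symmetric.\<close>
    have 1: "side y c \<subseteq> side x c \<and> side c y \<subseteq> side c x"
      if yx: "triple x y c \<in> C" "triple y x c \<in> C" for x y
    proof
      show "side y c \<subseteq> side x c"
        using merge_left[OF _ yx(1)] yx unfolding side_def by blast
      show "side c y \<subseteq> side c x"
      proof
        fix z assume "z \<in> side c y"
        then consider "z = c" | "triple c z y \<in> C"
          unfolding side_def by (auto simp: triple_commute)
        then show "z \<in> side c x"
        proof cases
          case 2
          then have "triple c z x \<in> C" using move_right[OF _ yx(1)] by blast
          then show ?thesis unfolding side_def by (auto simp: triple_commute)
        qed (simp add: side_def)
      qed
    qed
    show ?thesis using 1[of x a] 1[of a x] t by blast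
  qed simp
  then show "side x c = side a c" "side c x = side c a" by auto
qed

lemma sides_eq:
  assumes "x \<in> side a c" "w \<in> side c a"
  shows "side x w = side a c" "side w x = side c a"
proof -
  have "w \<in> side c x" using assms side_eq(2)[OF assms(1)] by simp
  then show "side x w = side a c" "side w x = side c a"
    using side_eq[OF assms(1)] side_eq[of w c x] by auto
qed

lemma self_side: "a \<in> side a c"
  by (simp add: side_def)

lemma not_in_side: "c \<noteq> a \<Longrightarrow> c \<notin> side a c"
  using in_C(2)[of c a c] by (auto simp: side_def)

text \<open>This is the descent of the later induction. Since \<open>xw|c\<close> is in
  \<open>C\<close>, the dyadic rules carry every element of the inner pair over to the side of
  \<open>x\<close> against \<open>c\<close>.\<close>

lemma sides_nested:
  assumes "triple x y w \<in> C" "x \<in> side a c" "w \<in> side a c"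
  shows "side x w \<union> side w x \<subseteq> side a c"
proof -
  have sx: "side x c = side a c" using side_eq[OF assms(2)] by simp
  have "w \<noteq> x" using in_C[OF assms(1)] by simp
  moreover have "w \<in> side x c" using assms(3) sx by simp
  ultimately have t: "triple w x c \<in> C" "triple x w c \<in> C"
    by (simp_all add: side_def triple_commute[of x w])
  show ?thesis
    unfolding sx[symmetric]
  proof
    fix z assume "z \<in> side x w \<union> side w x"
    then consider "z = x" | "z = w" | "triple z x w \<in> C" | "triple z w x \<in> C"
      unfolding side_def by blast
    then show "z \<in> side x c"
    proof cases
      case 3
      then show ?thesis using dyadic(1)[OF 3 t(2)] by (simp add: side_def)
    next
      case 4
      then show ?thesis using dyadic(2)[OF 4 t(1)] by (simp add: side_def)
    qed (use t in \<open>auto simp: side_def\<close>)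
  qed
qed

section \<open>The graph whose edges are the triples of a closed set\<close>

definition tag :: "'a \<Rightarrow> 'a \<Rightarrow> 'a set \<times> 'a set" where
  "tag a c = (side a c, side c a)"

text \<open>Each pair \<open>T\<close> has its own layer of vertices. These edges copy the Aho graph
  of \<open>C\<close> on the first set of \<open>T\<close> into that layer; they are the ones to
  contract.\<close>

definition inner_edges :: "(('a set \<times> 'a set) \<times> 'a) rel" where
  "inner_edges = {((T, x), (T, y)) | T x y. \<exists>w. triple x y w \<in> C \<and> x \<in> fst T \<and> y \<in> fst T \<and> w \<in> fst T}"

text \<open>The choice only orients the edge; see \<open>ends_triple\<close>.\<close>

definition ends :: "'a triple \<Rightarrow> (('a set \<times> 'a set) \<times> 'a) \<times> (('a set \<times> 'a set) \<times> 'a)" where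
  "ends t = (case SOME (a, b). fst t = {a, b} of
     (a, b) \<Rightarrow> ((tag a (snd t), a), (tag a (snd t), b)))"

text \<open>Since \<open>b\<close> lies in \<open>side a c\<close>, both possible choices lead to
  the same layer.\<close>

lemma ends_triple:
  assumes "triple a b c \<in> C"
  shows "ends (triple a b c) = ((tag a c, a), (tag a c, b)) \<or>
    ends (triple a b c) = ((tag a c, b), (tag a c, a))"
proof -
  obtain x y where xy: "(SOME (x, y). fst (triple a b c) = {x, y}) = (x, y)" by fastforce
  have "case (x, y) of (x, y) \<Rightarrow> fst (triple a b c) = {x, y}"
    unfolding xy[symmetric] by (rule someI[of _ "(a, b)"]) (simp add: triple_def)
  then have "x = a \<and> y = b \<or> x = b \<and> y = a"
    by (auto simp: triple_def doubleton_eq_iff)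
  moreover have "b \<in> side a c" using assms by (simp add: side_def triple_commute)
  then have "tag b c = tag a c" using side_eq[of b a c] by (simp add: tag_def)
  moreover have "ends (triple a b c) = ((tag x c, x), (tag x c, y))"
    unfolding ends_def xy by (simp add: triple_def)
  ultimately show ?thesis by auto
qed

sublocale edge_system inner_edges ends
proof
  show "sym inner_edges"
    unfolding sym_def inner_edges_def by (auto simp: triple_commute)
qed

lemma ends_link_iff:
  assumes "triple a b c \<in> C"
  shows "ends (triple a b c) \<in> link S \<longleftrightarrow> ((tag a c, a), (tag a c, b)) \<in> link S"
  using ends_triple[OF assms] link_sym[of "(tag a c, a)" "(tag a c, b)" S]
    link_sym[of "(tag a c, b)" "(tag a c, a)" S] by metis

section \<open>Spanning subsets and closure\<close>

lemma C_cases: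
  assumes "t \<in> C"
  obtains a b c where "t = triple a b c"
  using assms C_H0 laminar_triplesE by blast

text \<open>A path joining \<open>a\<close> and \<open>b\<close> in their layer is translated edge
  by edge. An edge of \<open>S\<close> there is a triple inside \<open>?X\<close>, hence an Aho
  edge. An inner edge is a triple of \<open>C\<close> with a smaller pair, so the induction replaces
  it by a path over \<open>S\<close>.\<close>

lemma spanning_aho:
  assumes S: "S \<subseteq> C" "ends ` C \<subseteq> link S" and t: "triple a b c \<in> C"
  shows "(a, b) \<in> aho S (side a c \<union> side c a)"
  using t
proof (induction "card (side a c \<union> side c a)" arbitrary: a b c rule: less_induct)
  case less
  let ?X = "side a c \<union> side c a"
  have fin: "finite ?X" using side_subset[OF less(2)] finite_L finite_subset by blast
  have "((tag a c, a), (tag a c, b)) \<in> link S"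
    using S(2) less(2) ends_link_iff[OF less(2)] by blast
  \<comment> \<open>Edges of both kinds stay within a layer, so the tag is part of the
    invariant.\<close>
  moreover have "fst v = tag a c \<and> (a, snd v) \<in> aho S ?X" if "((tag a c, a), v) \<in> link S" for v
    using that unfolding link_def
  proof (induction rule: rtrancl_induct)
    case base
    then show ?case by simp
  next
    case (step u v)
    have "fst v = fst u \<and> (snd u, snd v) \<in> aho S ?X"
      using step(2)
    proof (elim UnE)
      assume "(u, v) \<in> inner_edges"
      then obtain x y w where uv: "u = (fst u, x)" "v = (fst u, y)" "triple x y w \<in> C"
        "x \<in> fst (fst u)" "w \<in> fst (fst u)"
        unfolding inner_edges_def by auto
      then have xw: "x \<in> side a c" "w \<in> side a c" using step(3) by (auto simp: tag_def)
      have sub: "side x w \<union> side w x \<subseteq> side a c"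
        by (rule sides_nested[OF uv(3) xw])
      \<comment> \<open>The inner pair misses \<open>c\<close>, which makes the measure drop
        strictly.\<close>
      have "c \<notin> side a c" using not_in_side in_C[OF less(2)] by auto
      then have "side x w \<union> side w x \<subset> ?X" using sub self_side[of c a] by blast
      then have "(x, y) \<in> aho S (side x w \<union> side w x)"
        using less(1)[OF psubset_card_mono[OF fin] uv(3)] by blast
      moreover have "aho S (side x w \<union> side w x) \<subseteq> aho S ?X"
        by (rule aho_mono) (use sub in auto)
      ultimately show ?thesis using uv(1,2) by (metis fst_conv snd_conv subsetD)
    next
      \<comment> \<open>Stated symmetrically, because \<open>link\<close> may traverse the edge in
        either direction and the tag is known at only one end.\<close>
      have *: "fst v = fst u \<and> (snd u, snd v) \<in> aho S ?X \<and> (snd v, snd u) \<in> aho S ?X"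
        if s: "s \<in> S" "ends s = (u, v)" and T: "fst u = tag a c \<or> fst v = tag a c" for s u v
      proof -
        obtain x y w where xyw: "s = triple x y w" using s(1) S(1) C_cases by blast
        then have C: "triple x y w \<in> C" using s(1) S(1) by blast
        have uv: "u = (tag x w, x) \<and> v = (tag x w, y) \<or> u = (tag x w, y) \<and> v = (tag x w, x)"
          using ends_triple[OF C] s(2) xyw by auto
        then have "tag x w = tag a c" using T by auto
        then have "side x w = side a c" "side w x = side c a" by (auto simp: tag_def)
        moreover have "y \<in> side x w" using C by (simp add: side_def triple_commute)
        ultimately have "x \<in> ?X" "y \<in> ?X" "w \<in> ?X"
          using self_side[of x w] self_side[of w x] by auto
        then have "(x, y) \<in> aho S ?X"
          using s(1) xyw by (auto simp: aho_edges_def)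
        then show ?thesis using uv aho_sym[of x y S ?X] by auto
      qed
      {
        assume "(u, v) \<in> ends ` S"
        then show ?thesis using * step(3) by (metis imageE)
      next
        assume "(u, v) \<in> (ends ` S)\<inverse>"
        then show ?thesis using * step(3) by (metis converseD imageE)
      }
    qed
    then show ?case using step(3) by (metis rtrancl_trans)
  qed
  ultimately show ?case by fastforce
qed

lemma spanning_two_components:
  assumes S: "S \<subseteq> C" "ends ` C \<subseteq> link S" and t: "triple a b c \<in> C"
    and z: "z \<in> side a c \<union> side c a"
  shows "(a, z) \<in> aho S (side a c \<union> side c a) \<or> (c, z) \<in> aho S (side a c \<union> side c a)"
proof -
  consider "z = a" | "z = c" | "triple a z c \<in> C" | "triple c z a \<in> C"
    using z by (auto simp: side_def triple_commute)
  then show ?thesis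
  proof cases
    case 3
    then show ?thesis using spanning_aho[OF S 3] by simp
  next
    case 4
    then show ?thesis using spanning_aho[OF S 4] by (simp add: Un_commute)
  qed auto
qed

lemma spanning_closure:
  assumes S: "S \<subseteq> C" "ends ` C \<subseteq> link S"
  shows "C \<subseteq> laminar_closure L S"
proof
  fix t assume "t \<in> C"
  then obtain a b c where t: "t = triple a b c" "triple a b c \<in> C" using C_cases by metis
  let ?X = "side a c \<union> side c a"
  have X: "?X \<subseteq> L" "finite ?X" using side_subset[OF t(2)] finite_L finite_subset by blast+
  have in_X: "a \<in> ?X" "b \<in> ?X" "c \<in> ?X"
    using t(2) by (auto simp: side_def triple_commute)
  show "t \<in> laminar_closure L S"
    unfolding t(1) laminar_closure_iff
    using two_components_triple[OF _ _ X(2,1) in_X spanning_two_components[OF S t(2)]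
        in_C(1)[OF t(2)] spanning_aho[OF S t(2)]] by blast
qed

text \<open>The closure \<open>cl S\<close> is taken over the leaves of \<open>S\<close> itself, so
  a spanning \<open>S\<close> must not lose a leaf. The leaves \<open>a\<close> and \<open>b\<close>
  lie on Aho edges. If \<open>c\<close> were lost, it would be isolated, and the Aho graph on
  \<open>?X - {c}\<close> would be connected.\<close>

lemma spanning_leaf_set:
  assumes S: "S \<subseteq> C" "ends ` C \<subseteq> link S" and t: "triple a b c \<in> C"
  shows "a \<in> leaf_set S" "b \<in> leaf_set S" "c \<in> leaf_set S"
proof -
  have edge: "x \<in> leaf_set S" if "(x, y) \<in> aho S X" "x \<noteq> y" for x y X
    using that
  proof (cases rule: converse_rtranclE)
    case (step y')
    then obtain z where "triple x y' z \<in> S" by (auto simp: aho_edges_def)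
    from leaf_set_triple[OF this] show ?thesis by simp
  qed simp
  let ?X = "side a c \<union> side c a"
  have ab: "(a, b) \<in> aho S ?X" by (rule spanning_aho[OF S t])
  show a: "a \<in> leaf_set S" using edge[OF ab] in_C[OF t] by simp
  show "b \<in> leaf_set S" using edge[OF aho_sym[OF ab]] in_C[OF t] by simp
  show "c \<in> leaf_set S"
  proof (rule ccontr)
    assume c: "c \<notin> leaf_set S"
    have "aho_edges S ?X \<subseteq> aho_edges S (?X - {c})"
      using c leaf_set_triple[of _ _ _ S] unfolding aho_edges_def by blast
    then have "aho S ?X \<subseteq> aho S (?X - {c})" by (rule rtrancl_mono)
    moreover have "(a, z) \<in> aho S ?X" if "z \<in> ?X - {c}" for z
      using spanning_two_components[OF S t, of z] edge[of c z ?X] c that by blast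
    ultimately have "(a, z) \<in> aho S (?X - {c})" if "z \<in> ?X - {c}" for z
      using that by blast
    then have "aho_connected S (?X - {c})"
      unfolding aho_connected_def using aho_sym[of _ _ S "?X - {c}"] by (meson rtrancl_trans)
    moreover have "b \<in> ?X - {c}" "a \<in> ?X - {c}"
      using t in_C[OF t] by (auto simp: side_def triple_commute)
    moreover have "finite (?X - {c})"
      using side_subset[OF t] finite_L by (meson finite_Diff finite_subset)
    ultimately show False
      using not_aho_connected[OF laminar_H0 subset_trans[OF S(1) C_H0], of "?X - {c}" a b]
        in_C(1)[OF t] by blast
  qed
qed

text \<open>Bryant and Steel give a set \<open>X\<close> on which \<open>S\<close> has just the
  components of \<open>a\<close> and \<open>c\<close>. These lie in the two sides, so every edge of
  the Aho path from \<open>a\<close> to \<open>b\<close> can be lifted to the layer of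
  \<open>ab|c\<close>.\<close>

lemma closure_spanning:
  assumes S: "S \<subseteq> C" "C \<subseteq> laminar_closure L S"
  shows "ends ` C \<subseteq> link S"
proof (rule image_subsetI)
  fix t assume "t \<in> C"
  then obtain a b c where t: "t = triple a b c" "triple a b c \<in> C" using C_cases by metis
  have S_H0: "S \<subseteq> laminar_triples L H0" using S(1) C_H0 by blast
  obtain X where X: "X \<subseteq> L" "a \<in> X" "b \<in> X" "c \<in> X" "(a, b) \<in> aho S X"
    "\<And>z. z \<in> X \<Longrightarrow> (a, z) \<in> aho S X \<or> (c, z) \<in> aho S X"
    using closure_two_components[OF finite_L laminar_H0 S_H0, of a b c] t S(2) by blast
  have finX: "finite X" using X(1) finite_L finite_subset by blast
  have SH: "S \<subseteq> laminar_triples L H" if "C \<subseteq> laminar_triples L H" for H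
    using S(1) that by blast
  \<comment> \<open>A family displaying \<open>C\<close> displays \<open>S\<close>, so the two
    components force \<open>az|c\<close> into the closed set \<open>C\<close>.\<close>
  have left: "z \<in> side a c" if z: "z \<in> X" "(a, z) \<in> aho S X" for z
  proof (cases "z = a")
    case False
    have "triple a z c \<in> C"
      by (rule closedI)
        (rule two_components_triple[OF _ SH finX X(1,2) z(1) X(4,6) False[symmetric] z(2)])
    then show ?thesis by (simp add: side_def triple_commute)
  qed (simp add: self_side)
  have right: "z \<in> side c a" if z: "z \<in> X" "(c, z) \<in> aho S X" for z
  proof (cases "z = c")
    case False
    have two: "\<And>z. z \<in> X \<Longrightarrow> (c, z) \<in> aho S X \<or> (a, z) \<in> aho S X" using X(6) by blast
    have "triple c z a \<in> C"
      by (rule closedI)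
        (rule two_components_triple[OF _ SH finX X(1,4) z(1) X(2) two False[symmetric] z(2)])
    then show ?thesis by (simp add: side_def triple_commute)
  qed (simp add: self_side)
  have "((tag a c, a), (tag a c, z)) \<in> link S" if "(a, z) \<in> aho S X" for z
    using that
  proof (induction rule: rtrancl_induct)
    case base
    then show ?case by simp
  next
    case (step x y)
    then obtain w where w: "x \<in> X" "y \<in> X" "w \<in> X" "triple x y w \<in> S"
      by (auto simp: aho_edges_def)
    have "(a, y) \<in> aho S X" using step(1,2) by (rule rtrancl_into_rtrancl)
    then have xy: "x \<in> side a c" "y \<in> side a c" using left w step(1) by auto
    have C: "triple x y w \<in> C" using w(4) S(1) by blast
    have "((tag a c, x), (tag a c, y)) \<in> link S"
    \<comment> \<open>If \<open>w\<close> is in the component of \<open>a\<close>, the triple is an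
      inner edge of the layer; otherwise it is split by this very pair and is an edge of
      \<open>S\<close>.\<close>
    proof (cases "(a, w) \<in> aho S X")
      case True
      then have "w \<in> side a c" using left w by blast
      then have "((tag a c, x), (tag a c, y)) \<in> inner_edges"
        using C xy by (auto simp: inner_edges_def tag_def)
      then show ?thesis unfolding link_def by blast
    next
      case False
      then have "w \<in> side c a" using right w X(6) by blast
      then have "tag x w = tag a c" using sides_eq[OF xy(1)] by (simp add: tag_def)
      then show ?thesis using ends_link_iff[OF C, of S] ends_in_link[OF w(4)] by simp
    qed
    with step(3) show ?case by (rule link_trans)
  qed
  then show "ends t \<in> link S" using X(5) t ends_link_iff by blast
qed

lemma spanning_leaf_set_eq:
  assumes S: "S \<subseteq> C" "ends ` C \<subseteq> link S"
  shows "leaf_set S = leaf_set C"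
proof
  show "leaf_set S \<subseteq> leaf_set C" using S(1) by (auto simp: leaf_set_def)
  show "leaf_set C \<subseteq> leaf_set S"
  proof
    fix x assume "x \<in> leaf_set C"
    then obtain t where t: "t \<in> C" "x \<in> insert (snd t) (fst t)" by (auto simp: leaf_set_def)
    then obtain a b c where "t = triple a b c" "triple a b c \<in> C" using C_cases by metis
    then show "x \<in> leaf_set S" using spanning_leaf_set[OF S, of a b c] t(2) by (auto simp: triple_def)
  qed
qed

end

subsection \<open>Paths in trees\<close>

text \<open>The initial piece meets \<open>S\<close> only at its end, so a path inside
  \<open>S\<close> can be glued to it without repeating a vertex.\<close>

lemma (in wf_digraph) apath_first_hit:
  assumes "apath u p v" "S \<inter> set (awalk_verts u p) \<noteq> {}"
  obtains p1 p2 z where "p = p1 @ p2" "apath u p1 z" "apath z p2 v"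
    "set (awalk_verts u p1) \<inter> S = {z}"
proof -
  have "\<exists>p1 p2 z. p = p1 @ p2 \<and> apath u p1 z \<and> apath z p2 v \<and> set (awalk_verts u p1) \<inter> S = {z}"
    using assms
  proof (induction p arbitrary: u)
    case Nil
    then show ?case by (intro exI[of _ "[]"] exI[of _ u]) (auto simp: apath_Nil_iff)
  next
    case (Cons e p)
    have u: "u \<in> verts G" using Cons.prems(1) by (auto simp: apath_def)
    show ?case
    proof (cases "u \<in> S")
      case True
      then show ?thesis
        using Cons.prems(1) u by (intro exI[of _ "[]"] exI[of _ "e # p"] exI[of _ u]) (auto simp: apath_Nil_iff)
    next
      case False
      have e: "e \<in> arcs G" "tail G e = u" "apath (head G e) p v" "u \<notin> set (awalk_verts (head G e) p)"
        using Cons.prems(1) by (auto simp: apath_Cons_iff)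
      then have "S \<inter> set (awalk_verts (head G e) p) \<noteq> {}" using Cons.prems(2) False by auto
      from Cons.IH[OF e(3) this] obtain p1 p2 z where p: "p = p1 @ p2" "apath (head G e) p1 z"
        "apath z p2 v" "set (awalk_verts (head G e) p1) \<inter> S = {z}" by blast
      have "set (awalk_verts (head G e) p1) \<subseteq> set (awalk_verts (head G e) p)"
        using e(3) unfolding p(1) apath_def by (auto simp: awalk_verts_append)
      then have "u \<notin> set (awalk_verts (head G e) p1)" using e(4) by blast
      then have "apath u (e # p1) z" using e p by (auto simp: apath_Cons_iff)
      moreover have "set (awalk_verts u (e # p1)) \<inter> S = {z}" using p(4) False e(2) by simp
      moreover have "e # p = (e # p1) @ p2" using p(1) by simp
      ultimately show ?thesis using p(3) by blast
    qed
  qed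
  then show thesis using that by blast
qed

lemma (in wf_digraph) apath_split:
  assumes "apath u p v" "z \<in> set (awalk_verts u p)"
  obtains p1 p2 where "p = p1 @ p2" "apath u p1 z" "apath z p2 v"
proof -
  have "{z} \<inter> set (awalk_verts u p) \<noteq> {}" using assms(2) by simp
  from apath_first_hit[OF assms(1) this] obtain p1 p2 w where
    p: "p = p1 @ p2" "apath u p1 w" "apath w p2 v" "set (awalk_verts u p1) \<inter> {z} = {w}" .
  from p(4) have "w = z" by auto
  with p that show thesis by simp
qed

lemma (in wf_digraph) apath_append_verts:
  assumes "apath u p z" "apath z q v"
  shows "set (awalk_verts u (p @ q)) = set (awalk_verts u p) \<union> set (awalk_verts z q)"
  using assms by (intro set_awalk_verts_append) (auto simp: apath_def)

locale tree_graph = pair_graph T for T :: "'a pair_pre_digraph" +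
  assumes tree: "undirected_tree T"
begin

lemma apath_exists:
  assumes "u \<in> pverts T" "v \<in> pverts T"
  obtains p where "apath u p v"
proof -
  have "strongly_connected (with_proj T)"
    using tree symmetric_connected_imp_strongly_connected sym_arcs by (auto simp: undirected_tree_def)
  then have "reachable (with_proj T) u v"
    using assms by (auto simp: strongly_connected_def)
  then show thesis using that by (auto simp: reachable_apath)
qed

text \<open>Common first arcs are removed. When the paths diverge from \<open>u\<close> to
  \<open>x\<close> and \<open>y\<close>, the first is followed until it hits the second and then the
  second is traced back to \<open>y\<close>; closing up through \<open>u\<close> gives a forbidden
  cycle.\<close>

lemma apath_unique:
  assumes "apath u p v" "apath u q v"
  shows "p = q"
  using assms
proof (induction p arbitrary: u q)
  case Nil
  then show ?case using apath_nonempty_ends[of u q v] by (auto simp: apath_Nil_iff)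
next
  case (Cons e p)
  have "u \<noteq> v" using apath_nonempty_ends[OF Cons.prems(1)] by simp
  then have "q \<noteq> []" using Cons.prems(2) by (auto simp: apath_Nil_iff)
  then obtain f q' where q: "q = f # q'" by (cases q) auto
  obtain x where e: "e = (u, x)" "(u, x) \<in> parcs T" "apath x p v" "u \<notin> set (pawalk_verts x p)"
    using Cons.prems(1) by (cases e) (auto simp: apath_Cons_iff)
  obtain y where f: "f = (u, y)" "(u, y) \<in> parcs T" "apath y q' v" "u \<notin> set (pawalk_verts y q')"
    using Cons.prems(2) q by (cases f) (auto simp: apath_Cons_iff)
  show ?case
  proof (cases "x = y")
    case True
    then show ?thesis using Cons.IH[OF e(3)] f e q by simp
  next
    case False
    have "v \<in> set (pawalk_verts x p)" "v \<in> set (pawalk_verts y q')"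
      using e(3) f(3) by (auto simp: apath_def)
    then have "set (pawalk_verts y q') \<inter> set (pawalk_verts x p) \<noteq> {}" by blast
    from apath_first_hit[OF e(3) this] obtain p1 p2 z where p1: "p = p1 @ p2" "apath x p1 z"
      "apath z p2 v" "set (pawalk_verts x p1) \<inter> set (pawalk_verts y q') = {z}" .
    then have "z \<in> set (pawalk_verts y q')" by blast
    from apath_split[OF f(3) this] obtain q1 q2 where q1: "q' = q1 @ q2" "apath y q1 z" "apath z q2 v" .
    have rev: "apath z (rev_path q1) y" using q1(2) by simp
    have vp: "set (pawalk_verts x p1) \<subseteq> set (pawalk_verts x p)"
      using apath_append_verts[OF p1(2,3)] p1(1) by blast
    have vq: "set (pawalk_verts y q1) \<subseteq> set (pawalk_verts y q')"
      using apath_append_verts[OF q1(2,3)] q1(1) by blast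
    have vrev: "set (pawalk_verts z (rev_path q1)) = set (pawalk_verts y q1)"
      using awalk_verts_rev_path[of y q1 z] q1(2) by (simp add: apath_def)
    have hd: "hd (pawalk_verts z (rev_path q1)) = z" "last (pawalk_verts x p1) = z"
      using rev p1(2) by (auto simp: apath_def)
    obtain zs where zs: "pawalk_verts z (rev_path q1) = z # zs"
      using hd(1) awalk_verts_non_Nil[of z "rev_path q1"] by (metis list.collapse)
    have "z \<notin> set zs" using rev zs by (auto simp: apath_def)
    moreover have "set zs \<subseteq> set (pawalk_verts y q')" using zs vrev vq by auto
    moreover have "w = z" if "w \<in> set (pawalk_verts x p1)" "w \<in> set (pawalk_verts y q')" for w
      using p1(4) IntI[OF that] by simp
    ultimately have disj: "set (pawalk_verts x p1) \<inter> set zs = {}" by blast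
    let ?r = "p1 @ rev_path q1"
    have r: "apath x ?r y"
      unfolding apath_append_iff hd(2) using p1(2) rev zs disj by simp
    have "set (pawalk_verts x ?r) = set (pawalk_verts x p1) \<union> set (pawalk_verts y q1)"
      using apath_append_verts[OF p1(2) rev] vrev by simp
    then have u: "u \<notin> set (pawalk_verts x ?r)" using e(4) f(4) vp vq by auto
    have walk: "awalk x (?r @ [(y, u)]) u"
      using r arcs_symmetric[OF f(2)] in_arcsD1[OF f(2)]
      by (intro awalk_appendI[of x ?r y]) (auto simp: apath_def awalk_simps)
    have "pawalk_verts x (?r @ [(y, u)]) = pawalk_verts x ?r @ [u]"
      using awalk_verts_append[OF walk] by simp
    then have "distinct (pawalk_verts x (?r @ [(y, u)]))"
      using r u by (simp add: apath_def)
    moreover have "awalk u ((u, x) # ?r @ [(y, u)]) u"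
      using walk e(2) by (auto simp: awalk_Cons_iff)
    moreover have "pawalk_verts u ((u, x) # ?r @ [(y, u)]) = u # pawalk_verts x (?r @ [(y, u)])" by simp
    ultimately have "cycle ((u, x) # ?r @ [(y, u)])"
      unfolding cycle_def by (metis list.sel(3) list.distinct(1))
    \<comment> \<open>One arc between \<open>x\<close> and \<open>y\<close> and the two arcs at
      \<open>u\<close> make length three.\<close>
    moreover have "?r \<noteq> []" using r False by (metis apath_Nil_iff)
    then have "3 \<le> length ((u, x) # ?r @ [(y, u)])" by (cases ?r) auto
    ultimately show ?thesis using tree by (auto simp: undirected_tree_def)
  qed
qed

lemma path_verts_apath: "apath u p v \<Longrightarrow> path_verts T u v = set (pawalk_verts u p)"
proof -
  assume p: "apath u p v"
  then have "(THE p. apath u p v) = p" using apath_unique by blast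
  then show ?thesis by (simp add: path_verts_def)
qed

end

section \<open>Ancestors and clusters in a rooted tree\<close>

locale root_tree = tree_graph +
  fixes \<rho>
  assumes root: "\<rho> \<in> pverts T"
begin

abbreviation anc :: "'a \<Rightarrow> 'a set" where
  "anc x \<equiv> path_verts T x \<rho>"

lemma anc_apath:
  assumes "x \<in> pverts T"
  obtains p where "apath x p \<rho>" "anc x = set (pawalk_verts x p)"
  using apath_exists[OF assms root] path_verts_apath by metis

lemma anc_subset:
  assumes "x \<in> pverts T"
  shows "anc x \<subseteq> pverts T"
proof -
  obtain p where "apath x p \<rho>" "anc x = set (pawalk_verts x p)" using anc_apath[OF assms] .
  then show ?thesis by (auto simp: apath_def)
qed

lemma self_anc:
  assumes "x \<in> pverts T"
  shows "x \<in> anc x"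
proof -
  obtain p where "apath x p \<rho>" "anc x = set (pawalk_verts x p)" using anc_apath[OF assms] .
  then show ?thesis using hd_in_awalk_verts by auto
qed

text \<open>By uniqueness of paths, the part of a root path after \<open>v\<close> is the root path
  of \<open>v\<close>.\<close>

lemma anc_split:
  assumes "x \<in> pverts T" "v \<in> anc x"
  obtains p q where "apath x p v" "apath v q \<rho>" "anc x = set (pawalk_verts x p) \<union> anc v"
    "\<forall>u \<in> set (pawalk_verts x p). v \<in> anc u"
proof -
  obtain r where r: "apath x r \<rho>" "anc x = set (pawalk_verts x r)" using anc_apath[OF assms(1)] .
  have "v \<in> set (pawalk_verts x r)" using r(2) assms(2) by simp
  from apath_split[OF r(1) this] obtain p q where
    pq: "r = p @ q" "apath x p v" "apath v q \<rho>" .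
  have "anc x = set (pawalk_verts x p) \<union> anc v"
    using r pq apath_append_verts[OF pq(2,3)] path_verts_apath by simp
  moreover have "v \<in> anc u" if "u \<in> set (pawalk_verts x p)" for u
  proof -
    from apath_split[OF pq(2) that] obtain p1 p2 where
      p: "p = p1 @ p2" "apath x p1 u" "apath u p2 v" .
    have "apath x (p1 @ (p2 @ q)) \<rho>" using r(1) pq(1) p(1) by simp
    then have "apath u (p2 @ q) \<rho>"
      unfolding apath_append_iff[of x p1] using p(2) by (auto simp: apath_def)
    then have "anc u = set (pawalk_verts u p2) \<union> set (pawalk_verts v q)"
      using apath_append_verts[OF p(3) pq(3)] path_verts_apath by simp
    then show ?thesis using hd_in_awalk_verts[of v q] pq(3) by auto
  qed
  ultimately show thesis using that[OF pq(2,3)] by blast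
qed

lemma anc_mono:
  assumes "x \<in> pverts T" "v \<in> anc x"
  shows "anc v \<subseteq> anc x"
  by (rule anc_split[OF assms]) simp

lemma anc_chain:
  assumes "x \<in> pverts T" "v \<in> anc x" "w \<in> anc x"
  shows "v \<in> anc w \<or> w \<in> anc v"
  by (rule anc_split[OF assms(1,2)]) (use assms(3) in auto)

text \<open>The vertex \<open>m\<close> is the last common ancestor: the first vertex on the root
  path of \<open>a\<close> that is also an ancestor of \<open>b\<close>. The pieces from
  \<open>a\<close> and from \<open>b\<close> up to \<open>m\<close> share only \<open>m\<close>, so
  together they form the path from \<open>a\<close> to \<open>b\<close>.\<close>

lemma meet:
  assumes "a \<in> pverts T" "b \<in> pverts T"
  obtains m where "m \<in> anc a" "m \<in> anc b" "m \<in> path_verts T a b"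
    "\<forall>u \<in> path_verts T a b. m \<in> anc u" "\<forall>v \<in> anc a \<inter> anc b. v \<in> anc m"
proof -
  obtain p where p: "apath a p \<rho>" "anc a = set (pawalk_verts a p)" using anc_apath[OF assms(1)] .
  obtain q where q: "apath b q \<rho>" "anc b = set (pawalk_verts b q)" using anc_apath[OF assms(2)] .
  have "\<rho> \<in> anc a" "\<rho> \<in> anc b" using p q by (auto simp: apath_def)
  then have "anc b \<inter> set (pawalk_verts a p) \<noteq> {}" using p by blast
  from apath_first_hit[OF p(1) this] obtain p1 p2 m where
    m: "p = p1 @ p2" "apath a p1 m" "apath m p2 \<rho>" "set (pawalk_verts a p1) \<inter> anc b = {m}" .
  have mb: "m \<in> anc b" and mp1: "m \<in> set (pawalk_verts a p1)" using m(4) by auto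
  have anc_a: "anc a = set (pawalk_verts a p1) \<union> anc m"
    using p m(1) apath_append_verts[OF m(2,3)] path_verts_apath[OF m(3)] by simp
  then have ma: "m \<in> anc a" using mp1 by blast
  obtain q1 q2 where q1: "apath b q1 m" "apath m q2 \<rho>" "anc b = set (pawalk_verts b q1) \<union> anc m"
    and q1_anc: "\<forall>u \<in> set (pawalk_verts b q1). m \<in> anc u"
    using anc_split[OF assms(2) mb] .
  obtain r1 r2 where r1: "apath a r1 m" and r1_anc: "\<forall>u \<in> set (pawalk_verts a r1). m \<in> anc u"
    by (rule anc_split[OF assms(1) ma])
  have "r1 = p1" using apath_unique[OF r1 m(2)] .
  have rev: "apath m (rev_path q1) b" using q1(1) by simp
  have vrev: "pawalk_verts m (rev_path q1) = rev (pawalk_verts b q1)"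
    using awalk_verts_rev_path[of b q1 m] q1(1) by (simp add: apath_def)
  have hd: "hd (pawalk_verts m (rev_path q1)) = m" "last (pawalk_verts a p1) = m"
    using rev m(2) by (auto simp: apath_def)
  obtain zs where zs: "pawalk_verts m (rev_path q1) = m # zs"
    using hd(1) awalk_verts_non_Nil[of m "rev_path q1"] by (metis list.collapse)
  have "m \<notin> set zs" using rev zs by (auto simp: apath_def)
  moreover have "set (m # zs) = set (pawalk_verts b q1)" unfolding zs[symmetric] vrev by simp
  then have "set zs \<subseteq> anc b" using q1(3) by auto
  moreover have "w = m" if "w \<in> set (pawalk_verts a p1)" "w \<in> anc b" for w
    using m(4) IntI[OF that] by simp
  ultimately have "set (pawalk_verts a p1) \<inter> set zs = {}" by blast
  then have path: "apath a (p1 @ rev_path q1) b"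
    unfolding apath_append_iff hd(2) using m(2) rev zs by simp
  have ab: "path_verts T a b = set (pawalk_verts a p1) \<union> set (pawalk_verts b q1)"
    using path_verts_apath[OF path] apath_append_verts[OF m(2) rev] vrev by simp
  show thesis
  proof (rule that[OF ma mb])
    show "m \<in> path_verts T a b" using ab mp1 by blast
    show "\<forall>u \<in> path_verts T a b. m \<in> anc u"
      using ab r1_anc q1_anc \<open>r1 = p1\<close> by blast
    show "\<forall>v \<in> anc a \<inter> anc b. v \<in> anc m"
    proof
      fix v assume v: "v \<in> anc a \<inter> anc b"
      show "v \<in> anc m"
      proof (cases "v \<in> set (pawalk_verts a p1)")
        case True
        then have "v = m" using m(4) v by blast
        then show ?thesis using self_anc mb anc_subset[OF assms(2)] by blast
      next
        case False
        then show ?thesis using anc_a v by blast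
      qed
    qed
  qed
qed

text \<open>Every common ancestor of \<open>a\<close> and \<open>b\<close> is an ancestor of their
  meet, hence of each vertex on the path; a path vertex above \<open>c\<close> would put them all
  above \<open>c\<close>.\<close>

lemma path_disjoint_iff:
  assumes "a \<in> pverts T" "b \<in> pverts T" "c \<in> pverts T"
  shows "path_verts T a b \<inter> anc c = {} \<longleftrightarrow> (\<exists>v. v \<in> anc a \<and> v \<in> anc b \<and> v \<notin> anc c)"
proof -
  obtain m where m: "m \<in> anc a" "m \<in> anc b" "m \<in> path_verts T a b"
    "\<forall>u \<in> path_verts T a b. m \<in> anc u" "\<forall>v \<in> anc a \<inter> anc b. v \<in> anc m"
    using meet[OF assms(1,2)] .
  show ?thesis
  proof
    assume "path_verts T a b \<inter> anc c = {}"
    then show "\<exists>v. v \<in> anc a \<and> v \<in> anc b \<and> v \<notin> anc c" using m by blast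
  next
    assume "\<exists>v. v \<in> anc a \<and> v \<in> anc b \<and> v \<notin> anc c"
    then obtain v where v: "v \<in> anc a" "v \<in> anc b" "v \<notin> anc c" by blast
    show "path_verts T a b \<inter> anc c = {}"
    proof (rule ccontr)
      assume "\<not> ?thesis"
      then obtain u where u: "u \<in> path_verts T a b" "u \<in> anc c" by blast
      have "anc m \<subseteq> anc u" using m(4) u(1) anc_mono u(2) anc_subset[OF assms(3)] by blast
      moreover have "anc u \<subseteq> anc c" using anc_mono[OF assms(3) u(2)] .
      ultimately show False using m(5) v by blast
    qed
  qed
qed

definition clusters :: "'a set set" where
  "clusters = (\<lambda>v. {x \<in> leaves T. v \<in> anc x}) ` pverts T"

lemma leaves_subset: "leaves T \<subseteq> pverts T"
  by (auto simp: leaves_def)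

text \<open>The ancestors of a common leaf form a chain.\<close>

lemma laminar_clusters: "laminar clusters"
  unfolding laminar_def clusters_def
proof (intro ballI, elim imageE)
  fix X Y v w
  assume X: "X = {x \<in> leaves T. v \<in> anc x}" and Y: "Y = {x \<in> leaves T. w \<in> anc x}"
  show "X \<subseteq> Y \<or> Y \<subseteq> X \<or> X \<inter> Y = {}"
  proof (cases "X \<inter> Y = {}")
    case False
    then obtain x where "x \<in> leaves T" "v \<in> anc x" "w \<in> anc x" using X Y by blast
    then have "v \<in> anc w \<or> w \<in> anc v" using anc_chain leaves_subset by blast
    then show ?thesis using anc_mono leaves_subset unfolding X Y by blast
  qed simp
qed

lemma displayed_clusters: "displayed_triples T \<rho> = laminar_triples (leaves T) clusters"
proof -
  have *: "path_verts T a b \<inter> anc c = {} \<longleftrightarrow> (\<exists>X \<in> clusters. a \<in> X \<and> b \<in> X \<and> c \<notin> X)"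
    if abc: "a \<in> leaves T" "b \<in> leaves T" "c \<in> leaves T" for a b c
  proof -
    have "a \<in> pverts T" "b \<in> pverts T" "c \<in> pverts T" using abc leaves_subset by auto
    then have "path_verts T a b \<inter> anc c = {} \<longleftrightarrow> (\<exists>v \<in> pverts T. v \<in> anc a \<and> v \<in> anc b \<and> v \<notin> anc c)"
      using path_disjoint_iff[of a b c] anc_subset[of a] by blast
    also have "\<dots> \<longleftrightarrow> (\<exists>X \<in> clusters. a \<in> X \<and> b \<in> X \<and> c \<notin> X)"
      using abc by (simp add: clusters_def)
    finally show ?thesis .
  qed
  show ?thesis
    unfolding displayed_triples_def laminar_triples_def
    by (intro Collect_cong ex_cong1 conj_cong refl) (rule *)
qed

end

lemma rooted_treeD:
  assumes "rooted_tree T \<rho>"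
  shows "root_tree T \<rho>" "finite (leaves T)"
proof -
  interpret pair_graph T using assms by (simp add: rooted_tree_def undirected_tree_def)
  show "root_tree T \<rho>"
    by unfold_locales (use assms in \<open>auto simp: rooted_tree_def inner_vertices_def\<close>)
  show "finite (leaves T)" using pair_finite_verts by (simp add: leaves_def)
qed

subsection \<open>Trees from laminar families\<close>

locale parent_tree =
  fixes W :: "'a set" and r :: 'a and par :: "'a \<Rightarrow> 'a" and rank :: "'a \<Rightarrow> nat"
  assumes finite_W: "finite W" and root_W: "r \<in> W"
    and par_W: "\<And>x. x \<in> W \<Longrightarrow> x \<noteq> r \<Longrightarrow> par x \<in> W"
    and rank_par: "\<And>x. x \<in> W \<Longrightarrow> x \<noteq> r \<Longrightarrow> rank x < rank (par x)"
begin

definition up :: "'a rel" where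
  "up = (\<lambda>x. (x, par x)) ` (W - {r})"

definition graph :: "'a pair_pre_digraph" where
  "graph = \<lparr>pverts = W, parcs = up \<union> up\<inverse>\<rparr>"

lemma graph_simps [simp]: "pverts graph = W" "parcs graph = up \<union> up\<inverse>"
  by (simp_all add: graph_def)

lemma up_iff: "(x, y) \<in> up \<longleftrightarrow> x \<in> W \<and> x \<noteq> r \<and> y = par x"
  by (auto simp: up_def)

lemma up_W: "(x, y) \<in> up \<Longrightarrow> x \<in> W \<and> y \<in> W \<and> x \<noteq> y"
  using par_W[of x] rank_par[of x] by (auto simp: up_iff)

sublocale pair_graph graph
proof unfold_locales
  show "finite (parcs graph)" using finite_W by (simp add: up_def)
qed (use finite_W in \<open>auto simp: symmetric_def sym_def dest: up_W\<close>)

lemma up_rank: "(x, y) \<in> up\<^sup>* \<Longrightarrow> rank x \<le> rank y"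
  by (induction rule: rtrancl_induct) (use rank_par in \<open>fastforce simp: up_iff\<close>)+

text \<open>Iterating \<open>par\<close> reaches \<open>r\<close> since ranks increase in a finite
  set, and for the same reason no vertex repeats.\<close>

lemma root_apath:
  assumes "x \<in> W"
  shows "\<exists>p. apath x p r \<and> set (pawalk_verts x p) = up\<^sup>* `` {x}"
  using assms
proof (induction "card {y \<in> W. rank x < rank y}" arbitrary: x rule: less_induct)
  case less
  show ?case
  proof (cases "x = r")
    case True
    have "up\<^sup>* `` {r} = {r}" by (auto elim: converse_rtranclE simp: up_iff)
    then show ?thesis using True root_W by (intro exI[of _ "[]"]) (simp add: apath_Nil_iff)
  next
    case False
    let ?y = "par x"
    have y: "?y \<in> W" "rank x < rank ?y" using par_W rank_par less(2) False by auto
    have "{z \<in> W. rank ?y < rank z} \<subset> {z \<in> W. rank x < rank z}" using y by auto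
    then have "card {z \<in> W. rank ?y < rank z} < card {z \<in> W. rank x < rank z}"
      using finite_W by (simp add: psubset_card_mono)
    from less(1)[OF this y(1)] obtain p where
      p: "apath ?y p r" "set (pawalk_verts ?y p) = up\<^sup>* `` {?y}" by blast
    have step: "(x, ?y) \<in> up" using less(2) False by (simp add: up_iff)
    have "x \<notin> up\<^sup>* `` {?y}" using up_rank[of ?y x] y(2) by auto
    then have "apath x ((x, ?y) # p) r"
      using p step by (simp add: apath_Cons_iff)
    moreover have "up\<^sup>* `` {x} = insert x (up\<^sup>* `` {?y})"
    proof -
      have "(x, z) \<in> up\<^sup>* \<longleftrightarrow> z = x \<or> (?y, z) \<in> up\<^sup>*" for z
        using step by (auto elim!: converse_rtranclE[of x z] simp: up_iff intro: converse_rtrancl_into_rtrancl)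
      then show ?thesis by auto
    qed
    ultimately show ?thesis using p(2) by (intro exI[of _ "(x, ?y) # p"]) simp
  qed
qed

lemma reachable_all:
  assumes "x \<in> W" "y \<in> W"
  shows "reachable (with_proj graph) x y"
proof -
  obtain p where "apath x p r" using root_apath[OF assms(1)] by blast
  moreover obtain q where "apath y q r" using root_apath[OF assms(2)] by blast
  then have "apath r (rev_path q) y" by simp
  ultimately show ?thesis using reachable_trans reachable_apath by blast
qed

lemma connected_graph: "Digraph_Component.connected (with_proj graph)"
  unfolding connected_def
proof
  show "verts (with_proj (mk_symmetric (with_proj graph))) \<noteq> {}"
    using root_W by (auto simp: mk_symmetric_def)
next
  fix u v
  assume "u \<in> verts (with_proj (mk_symmetric (with_proj graph)))"
    "v \<in> verts (with_proj (mk_symmetric (with_proj graph)))"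
  then have "reachable (with_proj graph) u v"
    using reachable_all by (simp add: mk_symmetric_def)
  then show "reachable (with_proj (mk_symmetric (with_proj graph))) u v"
    by (rule reachable_mk_symmetricI)
qed

text \<open>Both neighbours in a cycle of a vertex of minimal rank have to be its parent.\<close>

lemma no_long_cycle:
  assumes "cycle p"
  shows "length p < 3"
proof -
  obtain u where u: "awalk u p u" "distinct (tl (pawalk_verts u p))" "p \<noteq> []"
    using assms unfolding cycle_def by blast
  have cas: "pcas u p u" and arcs: "set p \<subseteq> parcs graph" using u(1) by (auto simp: awalk_def)
  have v1: "pawalk_verts u p = map fst p @ [u]"
    using awalk_verts_conv[of u p] u(1,3) by (metis awalkE' last_snoc)
  have v2: "pawalk_verts u p = u # map snd p"
    using awalk_verts_conv'[OF cas] u(3) cas by (cases p) auto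
  have dsnd: "distinct (map snd p)" using u(2) v2 by simp
  have heads: "u \<in> set (map fst p)"
    using v1 v2 u(3) by (cases p) auto
  have lasts: "u \<in> set (map snd p)"
    using v1 v2 u(3) by (metis last.simps last_in_set last_snoc map_is_Nil_conv)
  \<comment> \<open>A closed walk has the same tails as heads, so by counting, distinct heads force
    distinct tails.\<close>
  have sets: "fst ` set p = snd ` set p"
  proof -
    have "set (map fst p @ [u]) = set (u # map snd p)" using v1 v2 by simp
    then show ?thesis using heads lasts by (simp add: insert_absorb)
  qed
  have "card (set (map fst p)) = length (map fst p)"
    using sets distinct_card[OF dsnd] by simp
  then have dfst: "distinct (map fst p)" by (rule card_distinct)
  have "finite (fst ` set p)" "fst ` set p \<noteq> {}" using u(3) by auto
  then obtain x where x: "x \<in> fst ` set p" and min: "\<And>y. y \<in> fst ` set p \<Longrightarrow> rank x \<le> rank y"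
    by (metis arg_min_if_finite(1) arg_min_least)
  have xq: "(x, par x) \<in> set p" and qx: "(par x, x) \<in> set p" and xr: "x \<in> W" "x \<noteq> r"
  proof -
    have down: "z = par x \<and> x \<in> W \<and> x \<noteq> r" if "(x, z) \<in> up \<union> up\<inverse>" "z \<in> fst ` set p" for z
      using that min[OF that(2)] rank_par[of z] by (auto simp: up_iff)
    obtain z where z: "(x, z) \<in> set p" using x by auto
    then have "(x, z) \<in> up \<union> up\<inverse>" "z \<in> fst ` set p" using arcs sets by (auto intro: rev_image_eqI)
    from down[OF this] z show "(x, par x) \<in> set p" "x \<in> W" "x \<noteq> r" by auto
    have "x \<in> snd ` set p" using x sets by simp
    then obtain y where y: "(y, x) \<in> set p" by auto
    then have "(x, y) \<in> up \<union> up\<inverse>" "y \<in> fst ` set p" using arcs by (auto intro: rev_image_eqI)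
    from down[OF this] y show "(par x, x) \<in> set p" by auto
  qed
  let ?q = "par x"
  have "?q \<noteq> x" using rank_par[OF xr] by auto
  \<comment> \<open>After the arc from \<open>x\<close> to its parent, the cycle continues with
    \<open>p2 @ p1\<close>. Tails being distinct, this begins with the arc back to \<open>x\<close>;
    no arc in it leaves \<open>x\<close>, so it ends there.\<close>
  obtain p1 p2 where p: "p = p1 @ (x, ?q) # p2" using xq by (meson split_list)
  have c: "pcas u p1 x" "pcas ?q p2 u"
    using cas unfolding p by auto
  have cs: "pcas ?q (p2 @ p1) x"
  proof -
    have "last (pawalk_verts ?q p2) = u" using awlast_if_cas[OF c(2)] .
    then show ?thesis using c by simp
  qed
  have d: "distinct (map fst (p2 @ p1))" "x \<notin> fst ` set (p2 @ p1)"
    using dfst unfolding p by auto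
  obtain f s where fs: "p2 @ p1 = f # s" using cs \<open>?q \<noteq> x\<close> by (cases "p2 @ p1") auto
  have f: "fst f = ?q" "pcas (snd f) s x" using cs unfolding fs by auto
  have "(?q, x) \<in> set (p2 @ p1)" using qx \<open>?q \<noteq> x\<close> unfolding p by auto
  then have "f = (?q, x)"
    using d(1) f(1) unfolding fs by (auto intro: rev_image_eqI)
  then have "pcas x s x" using f by simp
  then have "s = []" using d(2) unfolding fs by (cases s) auto
  then have "length (p2 @ p1) = 1" using fs by simp
  then show ?thesis unfolding p by simp
qed

lemma undirected_tree_graph: "undirected_tree graph"
proof -
  have "\<not> (cycle p \<and> 3 \<le> length p)" for p using no_long_cycle[of p] by auto
  then show ?thesis
    unfolding undirected_tree_def using connected_graph by blast
qed

sublocale root_tree graph r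
  by unfold_locales (use undirected_tree_graph root_W in auto)

lemma anc_up: "x \<in> W \<Longrightarrow> anc x = up\<^sup>* `` {x}"
  using root_apath path_verts_apath by blast

lemma deg_graph:
  assumes "v \<in> W"
  shows "deg graph v = card {x \<in> W - {r}. par x = v} + (if v = r then 0 else 1)"
proof -
  let ?ch = "{x \<in> W - {r}. par x = v}"
  have "out_arcs (with_proj graph) v = Pair v ` ?ch \<union> (if v = r then {} else {(v, par v)})"
  proof -
    have "out_arcs (with_proj graph) v = Pair v ` {w. (v, w) \<in> up \<union> up\<inverse>}"
      unfolding out_arcs_def by auto
    also have "{w. (v, w) \<in> up \<union> up\<inverse>} = ?ch \<union> (if v = r then {} else {par v})"
      unfolding Un_iff converse_iff up_iff using assms by auto
    finally show ?thesis by auto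
  qed
  moreover have "card (Pair v ` ?ch) = card ?ch"
    by (rule card_image) (auto simp: inj_on_def)
  \<comment> \<open>Ranks rise along \<open>par\<close>, so a parent is never also a child and the
    two counts add up.\<close>
  moreover have "(v, par v) \<notin> Pair v ` ?ch" if "v \<noteq> r"
  proof
    assume "(v, par v) \<in> Pair v ` ?ch"
    then have "par v \<in> W" "par v \<noteq> r" "par (par v) = v" by auto
    then show False using rank_par[of "par v"] rank_par[OF assms that] by simp
  qed
  moreover have "finite (Pair v ` ?ch)" using finite_W by simp
  ultimately show ?thesis
    unfolding deg_def out_degree_def by (cases "v = r") simp_all
qed

end

text \<open>A laminar family in normal form, to become the vertex set of a tree. The empty set is a
  member only if \<open>L\<close> is empty, which gives the one-vertex tree; a singleton
  \<open>L\<close> would make the root coincide with a leaf.\<close>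

locale cluster_tree =
  fixes L :: "'a::infinite set" and V :: "'a set set"
  assumes finite_L: "finite L" and card_L: "card L \<noteq> 1"
    and laminar_V: "laminar V" and V_L: "\<And>X. X \<in> V \<Longrightarrow> X \<subseteq> L" and top: "L \<in> V"
    and singletons: "\<And>x. x \<in> L \<Longrightarrow> {x} \<in> V" and nonempty: "\<And>X. X \<in> V \<Longrightarrow> X \<noteq> L \<Longrightarrow> X \<noteq> {}"
begin

lemma finite_V: "finite V"
  by (rule finite_subset[of _ "Pow L"]) (use V_L finite_L in auto)

lemma finite_cluster: "X \<in> V \<Longrightarrow> finite X"
  using V_L finite_L finite_subset by blast

text \<open>The members properly containing \<open>X\<close> share an element of \<open>X\<close>,
  so they are nested and one of least cardinality is the least.\<close>

lemma ex_parent: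
  assumes X: "X \<in> V" "X \<noteq> L"
  shows "\<exists>Y. Y \<in> V \<and> X \<subset> Y \<and> (\<forall>Z \<in> V. X \<subset> Z \<longrightarrow> Y \<subseteq> Z)"
proof -
  obtain x where x: "x \<in> X" using nonempty[OF X] by blast
  let ?S = "{Y \<in> V. X \<subset> Y}"
  have "L \<in> ?S" using top V_L[OF X(1)] X(2) by auto
  from ex_has_least_nat[of "\<lambda>Y. Y \<in> ?S", OF this, of card]
  obtain Y where Y: "Y \<in> ?S" and min: "\<forall>Z. Z \<in> ?S \<longrightarrow> card Y \<le> card Z" by blast
  have "Y \<subseteq> Z" if Z: "Z \<in> V" "X \<subset> Z" for Z
  proof (rule ccontr)
    assume n: "\<not> Y \<subseteq> Z"
    have "x \<in> Y" "x \<in> Z" using x Y Z by auto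
    then have "Z \<subset> Y" using laminarD[OF laminar_V, of Y Z x] Y Z n by blast
    then have "card Z < card Y" using Y finite_cluster by (simp add: psubset_card_mono)
    then show False using min Z by fastforce
  qed
  then show ?thesis using Y by blast
qed

definition parent :: "'a set \<Rightarrow> 'a set" where
  "parent X = (SOME Y. Y \<in> V \<and> X \<subset> Y \<and> (\<forall>Z \<in> V. X \<subset> Z \<longrightarrow> Y \<subseteq> Z))"

lemma parent:
  assumes "X \<in> V" "X \<noteq> L"
  shows "parent X \<in> V" "X \<subset> parent X" "\<And>Z. Z \<in> V \<Longrightarrow> X \<subset> Z \<Longrightarrow> parent X \<subseteq> Z"
  using someI_ex[OF ex_parent[OF assms]] unfolding parent_def by blast+

lemma no_children:
  assumes "x \<in> L"
  shows "{Y \<in> V - {L}. parent Y = {x}} = {}"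
proof -
  have "parent Y \<noteq> {x}" if "Y \<in> V - {L}" for Y
    using parent(2)[of Y] nonempty[of Y] that by (metis DiffE psubset_eq singletonI subset_singletonD)
  then show ?thesis by blast
qed

text \<open>Each element of \<open>X\<close> lies in a child, namely a largest proper subcluster
  around it. An element outside a first child then yields a second.\<close>

lemma two_children:
  assumes X: "X \<in> V" "X \<noteq> {}" "\<And>x. X \<noteq> {x}"
  shows "2 \<le> card {Y \<in> V - {L}. parent Y = X}"
proof -
  have child: "\<exists>Y. Y \<in> V \<and> Y \<noteq> L \<and> parent Y = X \<and> x \<in> Y" if x: "x \<in> X" for x
  proof -
    let ?S = "{Y \<in> V. x \<in> Y \<and> Y \<subset> X}"
    have xL: "x \<in> L" using x V_L X(1) by blast
    have x_S: "{x} \<in> ?S" using X(3)[of x] x singletons[OF xL] by auto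
    have "\<forall>Y. Y \<in> ?S \<longrightarrow> card Y < card X"
      using finite_cluster[OF X(1)] by (auto intro: psubset_card_mono)
    from ex_has_greatest_nat[of "\<lambda>Y. Y \<in> ?S", OF x_S this]
    obtain Y where Y: "Y \<in> ?S" and max: "\<forall>Z. Z \<in> ?S \<longrightarrow> card Z \<le> card Y" by blast
    have YL: "Y \<noteq> L" using Y V_L[OF X(1)] by auto
    note p = parent[OF _ YL]
    have "parent Y \<subseteq> X" using p(3)[of X] Y X(1) by auto
    moreover have "\<not> parent Y \<subset> X"
    proof
      assume "parent Y \<subset> X"
      then have "parent Y \<in> ?S" using p(1,2) Y by auto
      moreover have "card Y < card (parent Y)"
        using p(1,2) Y finite_cluster by (simp add: psubset_card_mono)
      ultimately show False using max by fastforce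
    qed
    ultimately show ?thesis using Y YL by auto
  qed
  obtain x where x: "x \<in> X" using X(2) by blast
  obtain Y where Y: "Y \<in> V" "Y \<noteq> L" "parent Y = X" "x \<in> Y" using child[OF x] by blast
  have "Y \<subset> X" using parent(2)[OF Y(1,2)] Y(3) by simp
  then obtain y where y: "y \<in> X" "y \<notin> Y" by blast
  obtain Z where Z: "Z \<in> V" "Z \<noteq> L" "parent Z = X" "y \<in> Z" using child[OF y(1)] by blast
  have "Y \<noteq> Z" using y(2) Z(4) by blast
  then have "card {Y, Z} = 2" by simp
  moreover have "card {Y, Z} \<le> card {Y \<in> V - {L}. parent Y = X}"
    by (rule card_mono) (use finite_V Y Z in auto)
  ultimately show ?thesis by simp
qed

text \<open>Leaves have to be vertices themselves, so \<open>{x}\<close> is coded by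
  \<open>x\<close>. The other clusters get fresh elements outside \<open>L\<close>, which exist
  because the type is infinite.\<close>

lemma ex_coding: "\<exists>f :: 'a set \<Rightarrow> 'a. inj_on f V \<and> (\<forall>x \<in> L. f {x} = x)"
proof -
  have "infinite (UNIV - L)" using finite_L infinite_UNIV by (simp add: Diff_infinite_finite)
  then obtain B where B: "finite B" "card B = card V" "B \<subseteq> UNIV - L"
    using infinite_arbitrarily_large by blast
  then obtain g where g: "bij_betw g V B"
    using finite_same_card_bij[OF finite_V] by metis
  define f where "f X = (if \<exists>x \<in> L. X = {x} then the_elem X else g X)" for X
  have gL: "g X \<notin> L" if "X \<in> V" for X using g B(3) that by (auto simp: bij_betw_def)
  have gi: "X = Y" if "X \<in> V" "Y \<in> V" "g X = g Y" for X Y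
    using g that by (auto simp: bij_betw_def dest: inj_onD)
  have "inj_on f V"
    by (rule inj_onI) (use gL gi in \<open>force simp: f_def split: if_splits\<close>)
  then show ?thesis by (intro exI[of _ f]) (simp add: f_def)
qed

definition code :: "'a set \<Rightarrow> 'a" where
  "code = (SOME f. inj_on f V \<and> (\<forall>x \<in> L. f {x} = x))"

lemma code: "inj_on code V" "\<And>x. x \<in> L \<Longrightarrow> code {x} = x"
  using someI_ex[OF ex_coding] unfolding code_def by blast+

definition cluster :: "'a \<Rightarrow> 'a set" where
  "cluster = inv_into V code"

lemma cluster_code [simp]: "X \<in> V \<Longrightarrow> cluster (code X) = X"
  unfolding cluster_def using code(1) by (rule inv_into_f_f)

lemma code_eq_iff [simp]: "X \<in> V \<Longrightarrow> Y \<in> V \<Longrightarrow> code X = code Y \<longleftrightarrow> X = Y"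
  using code(1) by (auto dest: inj_onD)

text \<open>Clusters grow strictly towards the root, so their cardinality serves as rank.\<close>

sublocale parent_tree "code ` V" "code L" "\<lambda>w. code (parent (cluster w))" "\<lambda>w. card (cluster w)"
proof
  fix w assume "w \<in> code ` V" "w \<noteq> code L"
  then obtain X where X: "w = code X" "X \<in> V" "X \<noteq> L" by blast
  then show "code (parent (cluster w)) \<in> code ` V" using parent(1) by simp
  show "card (cluster w) < card (cluster (code (parent (cluster w))))"
    using X parent[of X] finite_cluster by (simp add: psubset_card_mono)
qed (use finite_V top in auto)

lemma up_star_code:
  assumes "X \<in> V"
  shows "up\<^sup>* `` {code X} = code ` {Y \<in> V. X \<subseteq> Y}"
proof
  have "\<exists>Y \<in> V. w = code Y \<and> X \<subseteq> Y" if "(code X, w) \<in> up\<^sup>*" for w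
    using that
  proof (induction rule: rtrancl_induct)
    case base
    then show ?case using assms by blast
  next
    case (step v w)
    then obtain Y where Y: "Y \<in> V" "v = code Y" "X \<subseteq> Y" by blast
    then have "Y \<noteq> L" "w = code (parent Y)" using step(2) by (auto simp: up_iff)
    then show ?case using parent(1,2)[OF Y(1)] Y(3) by blast
  qed
  then show "up\<^sup>* `` {code X} \<subseteq> code ` {Y \<in> V. X \<subseteq> Y}" by blast
next
  \<comment> \<open>Climbing from \<open>X\<close> cannot skip \<open>Y\<close>, as
    \<open>parent X\<close> is the least proper superset of \<open>X\<close> in
    \<open>V\<close>.\<close>
  have "(code X, code Y) \<in> up\<^sup>*" if "Y \<in> V" "X \<subseteq> Y" for Y
    using assms that(2)
  proof (induction "card (Y - X)" arbitrary: X rule: less_induct)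
    case less
    show ?case
    proof (cases "X = Y")
      case False
      then have XL: "X \<noteq> L" and XY: "X \<subset> Y" using less(3) V_L[OF that(1)] by auto
      note p = parent[OF less(2) XL]
      have sub: "parent X \<subseteq> Y" using p(3)[OF that(1) XY] .
      have "Y - parent X \<subset> Y - X" using p(2) sub by blast
      then have "card (Y - parent X) < card (Y - X)"
        using finite_cluster[OF that(1)] by (simp add: psubset_card_mono)
      from less(1)[OF this p(1) sub] have "(code (parent X), code Y) \<in> up\<^sup>*" .
      moreover have "(code X, code (parent X)) \<in> up"
        using less(2) XL top by (simp add: up_iff)
      ultimately show ?thesis by (rule converse_rtrancl_into_rtrancl[rotated])
    qed simp
  qed
  then show "code ` {Y \<in> V. X \<subseteq> Y} \<subseteq> up\<^sup>* `` {code X}" by blast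
qed

lemma deg_code:
  assumes "X \<in> V"
  shows "deg graph (code X) = card {Y \<in> V - {L}. parent Y = X} + (if X = L then 0 else 1)"
proof -
  have "{w \<in> code ` V - {code L}. code (parent (cluster w)) = code X}
    = code ` {Y \<in> V - {L}. parent Y = X}"
    using assms top parent(1) by auto
  moreover have "inj_on code {Y \<in> V - {L}. parent Y = X}"
    by (rule inj_on_subset[OF code(1)]) auto
  ultimately show ?thesis
    using deg_graph[of "code X"] assms top by (simp add: card_image)
qed

lemma deg_leaf:
  assumes "x \<in> L"
  shows "deg graph x = 1"
proof -
  have "{x} \<noteq> L" using card_L by auto
  then show ?thesis
    using deg_code[OF singletons[OF assms]]
    unfolding code(2)[OF assms] no_children[OF assms] by simp
qed

lemma deg_inner:
  assumes "X \<in> V" "\<And>x. X \<noteq> {x}"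
  shows "deg graph (code X) \<noteq> 1" "X \<noteq> L \<Longrightarrow> 3 \<le> deg graph (code X)"
proof -
  show "3 \<le> deg graph (code X)" if "X \<noteq> L"
    using two_children[OF assms(1) nonempty assms(2)] deg_code[OF assms(1)] assms(1) that by simp
  show "deg graph (code X) \<noteq> 1"
  \<comment> \<open>The empty cluster occurs only as the root of the one-vertex tree, where the
    degree is zero.\<close>
  proof (cases "X = {}")
    case True
    then have "X = L" using nonempty assms(1) by blast
    then have "{Y \<in> V - {L}. parent Y = X} = {}" using True V_L by blast
    then show ?thesis unfolding deg_code[OF assms(1)] using \<open>X = L\<close> by (simp only: card.empty) simp
  next
    case False
    then show ?thesis using two_children[OF assms(1) _ assms(2)] deg_code[OF assms(1)] by simp
  qed
qed

lemma leaves_graph: "leaves graph = L"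
proof
  show "L \<subseteq> leaves graph"
  proof
    fix x assume x: "x \<in> L"
    have "x \<in> code ` V" using code(2)[OF x] singletons[OF x] by (metis imageI)
    then show "x \<in> leaves graph" using deg_leaf[OF x] by (simp add: leaves_def)
  qed
  show "leaves graph \<subseteq> L"
  proof
    fix w assume "w \<in> leaves graph"
    then obtain X where X: "X \<in> V" "w = code X" "deg graph (code X) = 1"
      by (auto simp: leaves_def)
    then obtain x where "X = {x}" using deg_inner(1)[of X] by blast
    then show "w \<in> L" using X V_L code(2) by auto
  qed
qed

lemma rooted_tree_graph: "rooted_tree graph (code L)"
  unfolding rooted_tree_def
proof (intro conjI ballI)
  show "undirected_tree graph" by (rule undirected_tree_graph)
  have "L \<noteq> {x}" for x using card_L by auto
  then show "code L \<in> inner_vertices graph"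
    using deg_inner(1)[OF top] top by (simp add: inner_vertices_def leaves_def)
  fix w assume "w \<in> inner_vertices graph - {code L}"
  then obtain X where X: "X \<in> V" "X \<noteq> L" "w = code X" "w \<notin> L"
    by (auto simp: inner_vertices_def leaves_graph)
  have "X \<noteq> {x}" for x using X V_L[OF X(1)] code(2)[of x] by auto
  then show "3 \<le> deg graph w" using deg_inner(2)[OF X(1)] X by simp
qed

lemma anc_leaf:
  assumes "x \<in> L"
  shows "anc x = code ` {Y \<in> V. x \<in> Y}"
proof -
  have "x \<in> code ` V" using code(2)[OF assms] singletons[OF assms] by (metis imageI)
  then show ?thesis
    using anc_up up_star_code[OF singletons[OF assms]] code(2)[OF assms] by simp
qed

lemma displayed_graph: "displayed_triples graph (code L) = laminar_triples L V"
proof -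
  have *: "path_verts graph a b \<inter> anc c = {} \<longleftrightarrow> (\<exists>X \<in> V. a \<in> X \<and> b \<in> X \<and> c \<notin> X)"
    if abc: "a \<in> L" "b \<in> L" "c \<in> L" for a b c
  proof -
    have "a \<in> pverts graph" "b \<in> pverts graph" "c \<in> pverts graph"
      using abc leaves_subset unfolding leaves_graph by auto
    from path_disjoint_iff[OF this] show ?thesis
      unfolding anc_leaf[OF abc(1)] anc_leaf[OF abc(2)] anc_leaf[OF abc(3)] by auto
  qed
  show ?thesis
    unfolding displayed_triples_def laminar_triples_def leaves_graph
    by (intro Collect_cong ex_cong1 conj_cong refl) (rule *)
qed

end

lemma laminar_tree_exists:
  fixes L :: "'a::infinite set"
  assumes "finite L" "card L \<noteq> 1" "laminar H"
  obtains T \<rho> where "rooted_tree T \<rho>" "leaves T = L" "displayed_triples T \<rho> = laminar_triples L H"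
proof -
  \<comment> \<open>The added sets separate no triple: a singleton cannot contain both
    \<open>a\<close> and \<open>b\<close>, and \<open>L\<close> contains \<open>c\<close>.\<close>
  define V where "V = insert L ((\<lambda>X. X \<inter> L) ` H \<union> (\<lambda>x. {x}) ` L - {{}})"
  have "laminar V"
    using assms(3) unfolding V_def laminar_def by blast
  then interpret cluster_tree L V
    by unfold_locales (use assms in \<open>auto simp: V_def\<close>)
  have *: "(\<exists>X \<in> V. a \<in> X \<and> b \<in> X \<and> c \<notin> X) \<longleftrightarrow> (\<exists>X \<in> H. a \<in> X \<and> b \<in> X \<and> c \<notin> X)"
    if "a \<in> L" "b \<in> L" "c \<in> L" "distinct [a, b, c]" for a b c
    using that unfolding V_def by auto
  have "laminar_triples L V = laminar_triples L H"
    unfolding laminar_triples_def by (intro Collect_cong ex_cong1 conj_cong refl) (rule *)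
  then show thesis
    using that[OF rooted_tree_graph leaves_graph] displayed_graph by simp
qed

subsection \<open>Closure via laminar families\<close>

lemma leaf_set_mono: "R \<subseteq> R' \<Longrightarrow> leaf_set R \<subseteq> leaf_set R'"
  unfolding leaf_set_def by (rule UN_mono) auto

text \<open>This discards the leaves of a displaying tree that do not occur in
  \<open>R\<close>.\<close>

lemma leaf_set_laminar_triples:
  assumes "R \<subseteq> laminar_triples L H"
  shows "leaf_set R \<subseteq> L" "R \<subseteq> laminar_triples (leaf_set R) H"
proof -
  have *: "insert (snd t) (fst t) \<subseteq> L \<and> t \<in> laminar_triples (leaf_set R) H" if t: "t \<in> R" for t
  proof -
    have "t \<in> laminar_triples L H" using assms t by blast
    then obtain a b c where abc: "t = triple a b c" "triple a b c \<in> laminar_triples L H"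
      by (metis laminar_triplesE)
    then have "a \<in> leaf_set R" "b \<in> leaf_set R" "c \<in> leaf_set R"
      using leaf_set_triple[of a b c R] t by auto
    then have "triple a b c \<in> laminar_triples (leaf_set R) H" and "a \<in> L" "b \<in> L" "c \<in> L"
      using abc(2) unfolding laminar_triples_iff by blast+
    then show ?thesis using abc(1) by (simp add: triple_def)
  qed
  show "leaf_set R \<subseteq> L"
    unfolding leaf_set_def by (rule UN_least) (use * in \<open>simp add: case_prod_beta\<close>)
  show "R \<subseteq> laminar_triples (leaf_set R) H" using * by blast
qed

lemma rooted_tree_laminar:
  assumes "rooted_tree T \<rho>"
  obtains H where "laminar H" "displayed_triples T \<rho> = laminar_triples (leaves T) H"
proof -
  interpret root_tree T \<rho> using rooted_treeD(1)[OF assms] .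
  show thesis using that[OF laminar_clusters displayed_clusters] .
qed

lemma consistentE:
  assumes "consistent R"
  obtains H where "laminar H" "R \<subseteq> laminar_triples (leaf_set R) H" "finite (leaf_set R)"
proof -
  obtain T \<rho> where T: "rooted_tree T \<rho>" "R \<subseteq> displayed_triples T \<rho>"
    using assms unfolding consistent_def by blast
  obtain H where H: "laminar H" "displayed_triples T \<rho> = laminar_triples (leaves T) H"
    using rooted_tree_laminar[OF T(1)] .
  have R: "R \<subseteq> laminar_triples (leaves T) H" using T(2) H(2) by simp
  show thesis
    using that[OF H(1) leaf_set_laminar_triples(2)[OF R]]
      finite_subset[OF leaf_set_laminar_triples(1)[OF R] rooted_treeD(2)[OF T(1)]] .
qed

lemma consistent_subset: "consistent R \<Longrightarrow> R' \<subseteq> R \<Longrightarrow> consistent R'"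
  unfolding consistent_def by blast

lemma card_leaf_set:
  assumes "R \<subseteq> laminar_triples L H"
  shows "card (leaf_set R) \<noteq> 1"
proof
  assume "card (leaf_set R) = 1"
  then obtain x where x: "leaf_set R = {x}" by (rule card_1_singletonE)
  then obtain t where t: "t \<in> R" unfolding leaf_set_def by blast
  then have "t \<in> laminar_triples L H" using assms by blast
  then obtain a b c where "t = triple a b c" "distinct [a, b, c]" by (rule laminar_triplesE)
  then show False using leaf_set_triple[of a b c R] t x by auto
qed

text \<open>Trees yield families through their clusters. Conversely a family yields a tree on
  \<open>leaf_set R\<close>, since this set is finite and not a singleton.\<close>

lemma cl_eq_laminar_closure:
  assumes "consistent R"
  shows "cl R = laminar_closure (leaf_set R) R"
proof -
  obtain H0 where H0: "laminar H0" "R \<subseteq> laminar_triples (leaf_set R) H0" "finite (leaf_set R)"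
    using consistentE[OF assms] .
  have "{displayed_triples T \<rho> | T \<rho>.
      rooted_tree T \<rho> \<and> leaves T = leaf_set R \<and> R \<subseteq> displayed_triples T \<rho>} =
    {laminar_triples (leaf_set R) H | H. laminar H \<and> R \<subseteq> laminar_triples (leaf_set R) H}"
  proof (intro equalityI subsetI)
    fix D assume "D \<in> {displayed_triples T \<rho> | T \<rho>.
      rooted_tree T \<rho> \<and> leaves T = leaf_set R \<and> R \<subseteq> displayed_triples T \<rho>}"
    then obtain T \<rho> where T: "D = displayed_triples T \<rho>" "rooted_tree T \<rho>"
      "leaves T = leaf_set R" "R \<subseteq> displayed_triples T \<rho>" by blast
    obtain H where "laminar H" "displayed_triples T \<rho> = laminar_triples (leaves T) H"
      using rooted_tree_laminar[OF T(2)] .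
    then show "D \<in> {laminar_triples (leaf_set R) H | H.
        laminar H \<and> R \<subseteq> laminar_triples (leaf_set R) H}"
      using T by auto
  next
    fix D assume "D \<in> {laminar_triples (leaf_set R) H | H.
      laminar H \<and> R \<subseteq> laminar_triples (leaf_set R) H}"
    then obtain H where H: "D = laminar_triples (leaf_set R) H" "laminar H"
      "R \<subseteq> laminar_triples (leaf_set R) H" by blast
    obtain T \<rho> where "rooted_tree T \<rho>" "leaves T = leaf_set R"
      "displayed_triples T \<rho> = laminar_triples (leaf_set R) H"
      using laminar_tree_exists[OF H0(3) card_leaf_set[OF H0(2)] H(2)] .
    then show "D \<in> {displayed_triples T \<rho> | T \<rho>.
        rooted_tree T \<rho> \<and> leaves T = leaf_set R \<and> R \<subseteq> displayed_triples T \<rho>}"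
      using H by blast
  qed
  then show ?thesis unfolding cl_def laminar_closure_def by simp
qed

lemma laminar_closure_extensive: "R \<subseteq> laminar_closure L R"
  unfolding laminar_closure_def by blast

lemma laminar_closure_mono: "R \<subseteq> R' \<Longrightarrow> laminar_closure L R \<subseteq> laminar_closure L R'"
  unfolding laminar_closure_def by blast

lemma laminar_closure_idem: "laminar_closure L (laminar_closure L R) \<subseteq> laminar_closure L R"
  unfolding laminar_closure_def by blast

lemma leaf_set_cl:
  assumes "consistent R"
  shows "leaf_set (cl R) = leaf_set R"
proof
  obtain H where H: "laminar H" "R \<subseteq> laminar_triples (leaf_set R) H"
    using consistentE[OF assms] .
  then have "cl R \<subseteq> laminar_triples (leaf_set R) H"
    unfolding cl_eq_laminar_closure[OF assms] laminar_closure_def by blast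
  then show "leaf_set (cl R) \<subseteq> leaf_set R" by (rule leaf_set_laminar_triples(1))
  show "leaf_set R \<subseteq> leaf_set (cl R)"
    unfolding cl_eq_laminar_closure[OF assms] by (rule leaf_set_mono[OF laminar_closure_extensive])
qed

lemma closed_triples_cl:
  assumes "consistent R"
  obtains H where "closed_triples (leaf_set R) (cl R) H"
proof -
  obtain H where H: "laminar H" "R \<subseteq> laminar_triples (leaf_set R) H" "finite (leaf_set R)"
    using consistentE[OF assms] .
  have "closed_triples (leaf_set R) (cl R) H"
    unfolding cl_eq_laminar_closure[OF assms]
  proof
    show "laminar_closure (leaf_set R) R \<subseteq> laminar_triples (leaf_set R) H"
      using H(1,2) unfolding laminar_closure_def by blast
  qed (use H laminar_closure_idem in auto)
  then show thesis by (rule that)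
qed

section \<open>Minimal representatives as bases of the matroid\<close>

locale closed_tree_triples = closed_triples L C H0
  for L :: "'a::infinite set" and C and H0
begin

text \<open>The conclusions mention \<open>R\<close> no longer: minimality within
  \<open>sc R\<close> becomes minimality among the spanning subsets, a notion that depends on
  \<open>C\<close> alone.\<close>

lemma minimal_representative_spanning:
  assumes R: "consistent R" "cl R = C" and L: "L = leaf_set C"
    and S: "S \<in> inclusion_minimal (sc R)"
  shows "S \<subseteq> C" "ends ` C \<subseteq> link S" "\<And>N. N \<subseteq> S \<Longrightarrow> ends ` C \<subseteq> link N \<Longrightarrow> N = S" "finite S"
proof -
  have SR: "S \<subseteq> R" "cl S = C" and min: "\<And>N. N \<in> sc R \<Longrightarrow> N \<subseteq> S \<Longrightarrow> N = S"
    using S R(2) unfolding inclusion_minimal_def sc_def by auto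
  have cons: "consistent N" if "N \<subseteq> S" for N
    using consistent_subset[OF R(1)] that SR(1) by blast
  have "leaf_set S = L" using leaf_set_cl[OF cons[OF subset_refl]] SR(2) L by simp
  then have C: "C = laminar_closure L S"
    using cl_eq_laminar_closure[OF cons[OF subset_refl]] SR(2) by simp
  show SC: "S \<subseteq> C" unfolding C by (rule laminar_closure_extensive)
  show "ends ` C \<subseteq> link S" by (rule closure_spanning[OF SC]) (simp add: C[symmetric])
  show "N = S" if N: "N \<subseteq> S" "ends ` C \<subseteq> link N" for N
  proof (rule min)
    have NC: "N \<subseteq> C" using N(1) SC by blast
    \<comment> \<open>A spanning set keeps all leaves, so its closure is taken over the same
      \<open>L\<close>.\<close>
    have "cl N = laminar_closure L N"
      using cl_eq_laminar_closure[OF cons[OF N(1)]] spanning_leaf_set_eq[OF NC N(2)] L by simp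
    also have "\<dots> = C"
    proof
      show "laminar_closure L N \<subseteq> C" unfolding C by (rule laminar_closure_mono[OF N(1)])
      show "C \<subseteq> laminar_closure L N" by (rule spanning_closure[OF NC N(2)])
    qed
    finally show "N \<in> sc R" using N(1) SR(1) R(2) by (simp add: sc_def)
  qed (rule N(1))
  have "S \<subseteq> Pow L \<times> L"
  proof
    fix t assume "t \<in> S"
    then have "t \<in> laminar_triples L H0" using SC C_H0 by blast
    then show "t \<in> Pow L \<times> L" by (rule laminar_triplesE) (auto simp: triple_def)
  qed
  then show "finite S" using finite_L by (meson finite_Pow_iff finite_SigmaI finite_subset)
qed

end

theorem mainTheorem4:
  fixes R1 R2 R1' R2' :: "'a::infinite triple set"
  assumes "triple_set R1" and "consistent R1"
    and "triple_set R2" and "consistent R2"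
    and "cl R1 = cl R2"
    and "R1' \<in> inclusion_minimal (sc R1)"
    and "R2' \<in> inclusion_minimal (sc R2)"
  shows "card R1' = card R2'"
proof -
  obtain H where "closed_triples (leaf_set R1) (cl R1) H"
    using closed_triples_cl[OF assms(2)] .
  then interpret closed_tree_triples "leaf_set R1" "cl R1" H
    by (rule closed_tree_triples.intro)
  have L: "leaf_set R1 = leaf_set (cl R1)" using leaf_set_cl[OF assms(2)] by simp
  \<comment> \<open>Both sets are minimal spanning sets of one matroid, that of the common
    closure.\<close>
  note 1 = minimal_representative_spanning[OF assms(2) refl L assms(6)]
  note 2 = minimal_representative_spanning[OF assms(4) assms(5)[symmetric] L assms(7)]
  show ?thesis by (rule minimal_spanning_card_eq[OF 1(1-3) 2(1-3) 1(4) 2(4)])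
qed

end
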